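(* Let $N\ge 1$, let $\varphi_1,\dots,\varphi_N$ be holomorphic self-maps of the unit disk $\mathbb{D}$, let $c_1,\dots,c_N\in\mathbb{C}$, and let $T=\sum_{j=1}^N c_j C_{\varphi_j}$ be the corresponding linear combination of the composition operators $C_{\varphi_j}$. Then the compactness of $T: H^p(\mathbb{D})\to H^p(\mathbb{D})$ does not depend on $p$ for $0<p<\infty$; that is, for all $p,q\in(0,\infty)$, $T: H^p(\mathbb{D})\to H^p(\mathbb{D})$ is compact if and only if $T: H^q(\mathbb{D})\to H^q(\mathbb{D})$ is compact.
   Context: $\mathbb{D}$ is the open unit disk of $\mathbb{C}$, $\mathbb{T}=\partial\mathbb{D}$, and $m$ is the normalized Lebesgue measure on $\mathbb{T}$. A holomorphic self-map of $\mathbb{D}$ is a holomorphic function $\varphi:\mathbb{D}\to\mathbb{D}$; the composition operator is $C_\varphi f=f\circ\varphi$ for $f$ holomorphic in $\mathbb{D}$. For $0<p<\infty$, the Hardy space $H^p(\mathbb{D})$ consists of all holomorphic $f$ in $\mathbb{D}$ with $\|f\|_{H^p}^p=\sup_{0<r<1}\int_{\mathbb{T}}|f(r\zeta)|^p\,dm(\zeta)<\infty$ (a quasi-Banach space). By the Littlewood subordination principle each $C_\varphi$ is bounded on $H^p(\mathbb{D})$ for every $p>0$. A linear operator between quasi-Banach spaces is compact if it maps the unit ball to a relatively compact set. *)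

theory Defs
  imports "HOL-Complex_Analysis.Complex_Analysis" "HOL-Probability.Probability"
begin

abbreviation unit_disk :: "complex set" where
  "unit_disk \<equiv> ball 0 1"

text \<open>Normalized Lebesgue measure on the unit circle, as a Borel measure on the plane.\<close>
definition circle_measure :: "complex measure" where
  "circle_measure = distr (uniform_measure lborel {0..2 * pi}) borel cis"

text \<open>The \<open>p\<close>-th power of the Hardy quasi-norm, possibly infinite.\<close>
definition hardy_power :: "real \<Rightarrow> (complex \<Rightarrow> complex) \<Rightarrow> ennreal" where
  "hardy_power p f =
     (SUP r\<in>{0<..<1::real}. \<integral>\<^sup>+ \<zeta>. ennreal (cmod (f (of_real r * \<zeta>)) powr p) \<partial>circle_measure)"

text \<open>A function on the disk is represented by its extension by \<open>0\<close>, so that equality of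
  elements of the space is equality of functions on the disk.\<close>
definition hardy_space :: "real \<Rightarrow> (complex \<Rightarrow> complex) set" where
  "hardy_space p =
     {f. f holomorphic_on unit_disk \<and> (\<forall>z. z \<notin> unit_disk \<longrightarrow> f z = 0) \<and> hardy_power p f < \<infinity>}"

definition hardy_norm :: "real \<Rightarrow> (complex \<Rightarrow> complex) \<Rightarrow> real" where
  "hardy_norm p f = enn2real (hardy_power p f) powr (1 / p)"

text \<open>The topology that a quasi-norm \<open>n\<close> induces on a space \<open>V\<close> of functions. Balls of a
  quasi-norm need not be open in general, so openness is defined directly: each point of the
  set is the centre of some ball contained in it.\<close>
definition quasinorm_topology ::
    "('a \<Rightarrow> complex) set \<Rightarrow> (('a \<Rightarrow> complex) \<Rightarrow> real) \<Rightarrow> ('a \<Rightarrow> complex) topology" where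
  "quasinorm_topology V n =
     topology (\<lambda>U. U \<subseteq> V \<and> (\<forall>f\<in>U. \<exists>e>0. \<forall>g\<in>V. n (\<lambda>x. g x - f x) < e \<longrightarrow> g \<in> U))"

lemma openin_quasinorm_topology:
  "openin (quasinorm_topology V n) U \<longleftrightarrow>
     U \<subseteq> V \<and> (\<forall>f\<in>U. \<exists>e>0. \<forall>g\<in>V. n (\<lambda>x. g x - f x) < e \<longrightarrow> g \<in> U)"
proof -
  let ?P = "\<lambda>U. U \<subseteq> V \<and> (\<forall>f\<in>U. \<exists>e>0. \<forall>g\<in>V. n (\<lambda>x. g x - f x) < e \<longrightarrow> g \<in> U)"
  have "?P (S \<inter> T)" if S: "?P S" and T: "?P T" for S T
  proof (intro conjI ballI)
    show "S \<inter> T \<subseteq> V" using S by blast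
    fix f assume f: "f \<in> S \<inter> T"
    obtain a where a: "a > 0" "\<forall>g\<in>V. n (\<lambda>x. g x - f x) < a \<longrightarrow> g \<in> S"
      using S f by blast
    obtain b where b: "b > 0" "\<forall>g\<in>V. n (\<lambda>x. g x - f x) < b \<longrightarrow> g \<in> T"
      using T f by blast
    show "\<exists>e>0. \<forall>g\<in>V. n (\<lambda>x. g x - f x) < e \<longrightarrow> g \<in> S \<inter> T"
      using a b by (intro exI[of _ "min a b"]) auto
  qed
  moreover have "?P (\<Union>\<K>)" if K: "\<forall>K\<in>\<K>. ?P K" for \<K>
  proof (intro conjI ballI)
    show "\<Union>\<K> \<subseteq> V" using K by blast
    fix f assume "f \<in> \<Union>\<K>"
    then obtain K where "K \<in> \<K>" "f \<in> K" by blast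
    then show "\<exists>e>0. \<forall>g\<in>V. n (\<lambda>x. g x - f x) < e \<longrightarrow> g \<in> \<Union>\<K>"
      using K by (meson UnionI)
  qed
  ultimately have "istopology ?P"
    unfolding istopology_def by blast
  then show ?thesis
    by (simp add: quasinorm_topology_def topology_inverse')
qed

lemma topspace_quasinorm_topology [simp]: "topspace (quasinorm_topology V n) = V"
proof
  show "topspace (quasinorm_topology V n) \<subseteq> V"
    using openin_quasinorm_topology openin_topspace by blast
  have "openin (quasinorm_topology V n) V"
    by (auto simp: openin_quasinorm_topology intro: exI[of _ 1])
  then show "V \<subseteq> topspace (quasinorm_topology V n)"
    by (rule openin_subset)
qed

text \<open>The inclusion in the ambient space is stated separately because \<open>closure_of\<close> ignores
  points outside it.\<close>
definition relatively_compactin :: "'a topology \<Rightarrow> 'a set \<Rightarrow> bool" where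
  "relatively_compactin X S \<longleftrightarrow> S \<subseteq> topspace X \<and> compactin X (X closure_of S)"

definition compact_on_hardy ::
    "real \<Rightarrow> ((complex \<Rightarrow> complex) \<Rightarrow> (complex \<Rightarrow> complex)) \<Rightarrow> bool" where
  "compact_on_hardy p T \<longleftrightarrow>
     relatively_compactin (quasinorm_topology (hardy_space p) (hardy_norm p))
       (T ` {f \<in> hardy_space p. hardy_norm p f \<le> 1})"

definition holomorphic_self_map :: "(complex \<Rightarrow> complex) \<Rightarrow> bool" where
  "holomorphic_self_map \<phi> \<longleftrightarrow> \<phi> holomorphic_on unit_disk \<and> \<phi> ` unit_disk \<subseteq> unit_disk"

definition comp_op :: "(complex \<Rightarrow> complex) \<Rightarrow> (complex \<Rightarrow> complex) \<Rightarrow> complex \<Rightarrow> complex" where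
  "comp_op \<phi> f = (\<lambda>z. if z \<in> unit_disk then f (\<phi> z) else 0)"

end

theory Submission
  imports Defs
begin

text \<open>
  Compactness of \<open>T\<close> on \<open>H\<^sup>p\<close> is first turned into a statement about sequences: \<open>T\<close> is compact
  iff \<open>T f\<^sub>n \<longlonglongrightarrow> 0\<close> in \<open>H\<^sup>p\<close> for each bounded sequence \<open>f\<^sub>n\<close> in \<open>H\<^sup>p\<close> that tends to \<open>0\<close> locally
  uniformly (lemmas \<open>compact_imp_null\<close> and \<open>null_imp_compact\<close>). This property is then carried
  from one exponent \<open>p\<close> to any other exponent \<open>q\<close> by an interpolation argument that works
  separately at each point of the disk.

  Let \<open>g\<^sub>n\<close> be bounded in \<open>H\<^sup>q\<close> and tend to \<open>0\<close>. After a dilation \<open>g\<^sub>n\<close> is holomorphic across the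
  circle. Then there is an entire function \<open>W\<^sub>n\<close> with \<open>Re W\<^sub>n \<ge> 1\<close> on the disk,
  \<open>\<bar>g\<^sub>n\<bar> \<le> \<bar>W\<^sub>n\<bar> powr (2 / q)\<close>, and \<open>W\<^sub>n\<close> bounded in \<open>H\<^sup>2\<close> (\<open>half_plane_majorant\<close>). As \<open>W\<^sub>n\<close> takes
  its values in a half plane, \<open>\<bar>W\<^sub>n powr s\<bar>\<close> is comparable to \<open>\<bar>W\<^sub>n\<bar> powr Re s\<close> for \<open>s\<close> in a
  horizontal strip. Hence \<open>E\<^sub>n s = g\<^sub>n * W\<^sub>n powr (s - 2 / q)\<close> is an analytic family with
  \<open>E\<^sub>n (2 / q) = g\<^sub>n\<close> whose members on the line \<open>Re s = 2 / p\<close> are bounded in \<open>H\<^sup>p\<close> and tend to \<open>0\<close>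
  pointwise. The hypothesis at the exponent \<open>p\<close> makes \<open>T (E\<^sub>n s)\<close> small in \<open>H\<^sup>p\<close> for each \<open>s\<close> on
  that line.

  At a fixed point \<open>w\<close> of the disk, \<open>s \<mapsto> T (E\<^sub>n s) w\<close> is an exponential sum with one term for each
  of the maps. Divided by \<open>M powr s\<close>, where \<open>M\<close> is the sum of the numbers \<open>\<bar>W\<^sub>n (\<phi>\<^sub>j w)\<bar>\<close>, it is
  holomorphic and bounded in the strip by a constant that does not depend on \<open>n\<close> and \<open>w\<close>. By
  Montel's theorem and the identity theorem such a function is small at \<open>2 / q\<close> as soon as it
  is small at enough points \<open>2 / p + \<i> / k\<close> (\<open>two_constants_normal_families\<close>); this bounds
  \<open>\<bar>T g\<^sub>n w\<bar> powr q\<close> by \<open>\<delta> M\<^sup>2\<close> plus a multiple of finitely many \<open>\<bar>T (E\<^sub>n s) w\<bar> powr p\<close>. Integration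
  over circles gives the claim, as Littlewood subordination bounds the integral of \<open>M\<^sup>2\<close>.

  The growth estimate, Littlewood's principle and the function \<open>W\<^sub>n\<close> all come from one fact,
  \<open>harmonic_majorant\<close>: \<open>\<bar>g\<bar> powr p\<close> lies below the real part of an entire function that is
  almost equal to it on the circle. Working with entire functions replaces Poisson integrals,
  boundary values and Blaschke products.
\<close>

section \<open>Means over the unit circle\<close>

definition circle_mean :: "(complex \<Rightarrow> 'a::euclidean_space) \<Rightarrow> 'a" where
  "circle_mean F = (1 / (2 * pi)) *\<^sub>R integral {0..2 * pi} (\<lambda>t. F (cis t))"

lemma cis_integrable:
  fixes F :: "complex \<Rightarrow> 'a::euclidean_space"
  assumes "continuous_on (sphere 0 1) F"
  shows "(\<lambda>t. F (cis t)) integrable_on {0..2 * pi}"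
proof -
  have "continuous_on {0..2*pi} (\<lambda>t. F (cis t))"
    by (rule continuous_on_compose2[OF assms]) (auto intro!: continuous_intros)
  then show ?thesis by (rule integrable_continuous_interval)
qed

lemma circle_mean_cong:
  assumes "\<And>z. cmod z = 1 \<Longrightarrow> F z = G z"
  shows "circle_mean F = circle_mean G"
  unfolding circle_mean_def using assms by simp

lemma circle_mean_const [simp]: "circle_mean (\<lambda>z. c) = c"
  by (simp add: circle_mean_def)

lemma circle_mean_add:
  assumes "continuous_on (sphere 0 1) F" "continuous_on (sphere 0 1) G"
  shows "circle_mean (\<lambda>z. F z + G z) = circle_mean F + circle_mean G"
  unfolding circle_mean_def
  by (subst Henstock_Kurzweil_Integration.integral_add) (auto intro: cis_integrable assms simp: scaleR_right_distrib)

lemma circle_mean_cmult: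
  fixes F :: "complex \<Rightarrow> real"
  shows "circle_mean (\<lambda>z. a * F z) = a * circle_mean F"
  unfolding circle_mean_def by simp

lemma circle_mean_sum:
  assumes "finite I" "\<And>i. i \<in> I \<Longrightarrow> continuous_on (sphere 0 1) (F i)"
  shows "circle_mean (\<lambda>z. \<Sum>i\<in>I. F i z) = (\<Sum>i\<in>I. circle_mean (F i))"
  using assms
  by (induction rule: finite_induct) (auto simp: circle_mean_add continuous_on_sum)

lemma circle_mean_mono:
  fixes F G :: "complex \<Rightarrow> real"
  assumes "continuous_on (sphere 0 1) F" "continuous_on (sphere 0 1) G"
    and "\<And>z. cmod z = 1 \<Longrightarrow> F z \<le> G z"
  shows "circle_mean F \<le> circle_mean G"
proof -
  have "integral {0..2 * pi} (\<lambda>t. F (cis t)) \<le> integral {0..2 * pi} (\<lambda>t. G (cis t))"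
    by (rule integral_le) (auto intro: cis_integrable assms)
  then show ?thesis unfolding circle_mean_def by (simp add: divide_right_mono)
qed

lemma circle_mean_nonneg:
  fixes F :: "complex \<Rightarrow> real"
  assumes "continuous_on (sphere 0 1) F" "\<And>z. cmod z = 1 \<Longrightarrow> 0 \<le> F z"
  shows "0 \<le> circle_mean F"
  using circle_mean_mono[of "\<lambda>_. 0" F] assms by simp

lemma circle_mean_Re:
  assumes "continuous_on (sphere 0 1) F"
  shows "circle_mean (\<lambda>z. Re (F z)) = Re (circle_mean F)"
proof -
  have "((\<lambda>t. F (cis t)) has_integral integral {0..2*pi} (\<lambda>t. F (cis t))) {0..2*pi}"
    using cis_integrable[OF assms] by blast
  from has_integral_Re[OF this] show ?thesis
    unfolding circle_mean_def by (simp add: integral_unique)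
qed

text \<open>Cauchy's formula at the centre.\<close>

lemma circle_mean_holomorphic:
  assumes "continuous_on (cball 0 1) F" "F holomorphic_on ball 0 1"
  shows "circle_mean F = F 0"
proof -
  have "((\<lambda>u. F u / (u - 0)) has_contour_integral (2 * of_real pi * \<i> * F 0)) (circlepath 0 1)"
    by (rule Cauchy_integral_circlepath) (use assms in auto)
  then have "((\<lambda>t. F (0 + of_real 1 * cis t) / (0 + of_real 1 * cis t - 0) * of_real 1 * \<i> * cis t)
       has_integral (2 * of_real pi * \<i> * F 0)) {0..2*pi}"
    unfolding circlepath_def by (subst (asm) has_contour_integral_part_circlepath_iff) auto
  then have "((\<lambda>t. \<i> * F (cis t)) has_integral (2 * of_real pi * \<i> * F 0)) {0..2*pi}"
    by (rule has_integral_eq_rhs[OF has_integral_eq, rotated]) (auto simp: field_simps)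
  from has_integral_mult_right[OF this, of "- \<i> / (2 * pi)"]
  have "((\<lambda>t. F (cis t) / (2 * pi)) has_integral F 0) {0..2*pi}"
    by (simp add: field_simps)
  from has_integral_mult_right[OF this, of "2 * pi"]
  have "((\<lambda>t. F (cis t)) has_integral (2 * pi * F 0)) {0..2*pi}"
    by (simp add: field_simps)
  then show ?thesis unfolding circle_mean_def
    by (simp add: integral_unique scaleR_conv_of_real)
qed

lemma sets_circle_measure [simp, measurable_cong]: "sets circle_measure = sets borel"
  by (simp add: circle_measure_def)

lemma cis_measurable [measurable]: "cis \<in> borel_measurable (uniform_measure lborel {0..2*pi})"
proof -
  have "cis \<in> borel_measurable borel"
    by (intro borel_measurable_continuous_onI continuous_intros)
  then show ?thesis by (simp add: measurable_cong_sets[OF sets_uniform_measure refl])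
qed

lemma AE_circle_measure: "AE z in circle_measure. cmod z = 1"
  unfolding circle_measure_def by (subst AE_distr_iff) auto

text \<open>The bridge between the Lebesgue integrals in the definition of the Hardy spaces and the
  gauge integrals above, which are easier to combine with Cauchy's formula.\<close>

lemma nn_integral_circle_measure:
  fixes u :: "complex \<Rightarrow> real"
  assumes cont: "continuous_on (sphere 0 1) u" and nn: "\<And>z. cmod z = 1 \<Longrightarrow> 0 \<le> u z"
  shows "(\<integral>\<^sup>+ z. ennreal (u z) \<partial>circle_measure) = ennreal (circle_mean u)"
proof -
  define v where "v z = indicator (sphere 0 1) z *\<^sub>R u z" for z
  have [measurable]: "v \<in> borel_measurable borel"
    unfolding v_def by (rule borel_measurable_continuous_on_indicator[OF _ cont]) auto
  have [measurable]: "cis \<in> borel_measurable borel"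
    by (intro borel_measurable_continuous_onI continuous_intros)
  have "(\<integral>\<^sup>+ z. ennreal (u z) \<partial>circle_measure) = (\<integral>\<^sup>+ z. ennreal (v z) \<partial>circle_measure)"
    by (rule nn_integral_cong_AE) (use AE_circle_measure in \<open>auto simp: v_def elim!: eventually_mono\<close>)
  also have "\<dots> = (\<integral>\<^sup>+ t. ennreal (v (cis t)) \<partial>uniform_measure lborel {0..2*pi})"
    unfolding circle_measure_def by (subst nn_integral_distr) auto
  also have "\<dots> = (\<integral>\<^sup>+ t. ennreal (v (cis t)) * indicator {0..2*pi} t \<partial>lborel) / emeasure lborel {0..2*pi}"
    by (rule nn_integral_uniform_measure) auto
  also have "(\<integral>\<^sup>+ t. ennreal (v (cis t)) * indicator {0..2*pi} t \<partial>lborel)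
      = (\<integral>\<^sup>+ t. ennreal (u (cis t)) * indicator {0..2*pi} t \<partial>lborel)"
    by (simp add: v_def)
  also have "\<dots> = ennreal (integral {0..2*pi} (\<lambda>t. u (cis t)))"
    by (rule nn_integral_has_integral_lebesgue') (use nn cis_integrable[OF cont] in auto)
  also have "ennreal (integral {0..2*pi} (\<lambda>t. u (cis t))) / emeasure lborel {0..2*pi} = ennreal (circle_mean u)"
    using integral_nonneg[OF cis_integrable[OF cont]] nn
    by (subst emeasure_lborel_Icc) (auto simp: circle_mean_def divide_ennreal)
  finally show ?thesis .
qed

section \<open>Majorants by real parts of entire functions\<close>

text \<open>The restrictions of real trigonometric polynomials to the circle: each of them is the real
  part of an algebraic polynomial.\<close>

definition circle_harmonic :: "(complex \<Rightarrow> real) set" where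
  "circle_harmonic = {u. continuous_on (sphere 0 1) u \<and> (\<exists>p. \<forall>z\<in>sphere 0 1. u z = Re (poly p z))}"

lemma circle_harmonicI:
  assumes "\<And>z. cmod z = 1 \<Longrightarrow> u z = Re (poly p z)"
  shows "u \<in> circle_harmonic"
proof -
  have "continuous_on (sphere 0 1) (\<lambda>z. Re (poly p z))" by (intro continuous_intros)
  then have "continuous_on (sphere 0 1) u"
    by (rule continuous_on_eq) (use assms in auto)
  then show ?thesis using assms by (auto simp: circle_harmonic_def)
qed

lemma circle_harmonic_add:
  assumes "u \<in> circle_harmonic" "v \<in> circle_harmonic"
  shows "(\<lambda>z. u z + v z) \<in> circle_harmonic"
proof -
  obtain p q where "\<forall>z\<in>sphere 0 1. u z = Re (poly p z)" "\<forall>z\<in>sphere 0 1. v z = Re (poly q z)"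
    using assms by (auto simp: circle_harmonic_def)
  then show ?thesis by (intro circle_harmonicI[of _ "p + q"]) auto
qed

lemma circle_harmonic_sum:
  assumes "finite I" "\<And>i. i \<in> I \<Longrightarrow> u i \<in> circle_harmonic"
  shows "(\<lambda>z. \<Sum>i\<in>I. u i z) \<in> circle_harmonic"
  using assms
proof (induction rule: finite_induct)
  case empty
  then show ?case by (intro circle_harmonicI[of _ 0]) auto
qed (auto intro: circle_harmonic_add)

text \<open>On the circle \<open>cnj z\<close> is \<open>1 / z\<close>, so for \<open>n \<le> m\<close> both \<open>z ^ m * z ^ n\<close> and \<open>z ^ m * cnj (z ^ n)\<close> are
  powers of \<open>z\<close> with a nonnegative exponent; a product of real parts is half the sum of two such
  real parts.\<close>

lemma circle_harmonic_monom_mult: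
  "(\<lambda>z. Re (a * z ^ m) * Re (b * z ^ n)) \<in> circle_harmonic"
proof -
  have *: "(\<lambda>z. Re (a * z ^ m) * Re (b * z ^ n)) \<in> circle_harmonic" if "n \<le> m" for a b m n
  proof (rule circle_harmonicI)
    fix z :: complex assume z: "cmod z = 1"
    have zz: "z ^ n * cnj z ^ n = 1"
      using z by (simp add: power_mult_distrib[symmetric] complex_norm_square[symmetric])
    have "z ^ m = z ^ (m - n) * z ^ n" using that by (simp add: power_add[symmetric])
    then have "a * z ^ m * cnj (b * z ^ n) = a * cnj b * z ^ (m - n) * (z ^ n * cnj z ^ n)"
      by (simp add: mult_ac)
    then have "a * z ^ m * cnj (b * z ^ n) = a * cnj b * z ^ (m - n)"
      using zz by simp
    moreover have "Re x * Re y = Re ((x * y + x * cnj y) / 2)" for x y :: complex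
      by simp
    ultimately show "Re (a * z ^ m) * Re (b * z ^ n)
       = Re (poly (monom (a * b / 2) (m + n) + monom (a * cnj b / 2) (m - n)) z)"
      by (simp only: poly_add poly_monom) (simp add: power_add add_divide_distrib mult_ac)
  qed
  show ?thesis
  proof (cases "n \<le> m")
    case False
    then show ?thesis using *[of m n b a] by (simp add: mult.commute)
  qed (use * in auto)
qed

lemma circle_harmonic_mult:
  assumes "u \<in> circle_harmonic" "v \<in> circle_harmonic"
  shows "(\<lambda>z. u z * v z) \<in> circle_harmonic"
proof -
  obtain p q where pq: "\<forall>z\<in>sphere 0 1. u z = Re (poly p z)" "\<forall>z\<in>sphere 0 1. v z = Re (poly q z)"
    using assms by (auto simp: circle_harmonic_def)
  define w where "w z = (\<Sum>i\<le>degree p. \<Sum>j\<le>degree q. Re (coeff p i * z ^ i) * Re (coeff q j * z ^ j))" for z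
  have "w \<in> circle_harmonic"
    unfolding w_def by (intro circle_harmonic_sum circle_harmonic_monom_mult) auto
  then obtain r where r: "\<forall>z\<in>sphere 0 1. w z = Re (poly r z)" by (auto simp: circle_harmonic_def)
  show ?thesis
  proof (rule circle_harmonicI)
    fix z :: complex assume z: "cmod z = 1"
    have "u z * v z = (\<Sum>i\<le>degree p. Re (coeff p i * z ^ i)) * (\<Sum>j\<le>degree q. Re (coeff q j * z ^ j))"
      using pq z by (simp add: poly_altdef)
    also have "\<dots> = w z" unfolding w_def sum_product ..
    finally show "u z * v z = Re (poly r z)" using r z by simp
  qed
qed

text \<open>By Stone-Weierstrass. The normalization at \<open>0\<close> only subtracts an imaginary constant; it makes
  \<open>Q 0\<close> equal to the mean of \<open>Re Q\<close>.\<close>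

lemma circle_approx_Re_entire:
  assumes "continuous_on (sphere 0 1) u" "e > 0"
  obtains Q where "Q holomorphic_on UNIV" "Im (Q 0) = 0"
    "\<And>z. cmod z = 1 \<Longrightarrow> \<bar>u z - Re (Q z)\<bar> < e"
proof -
  interpret circle_harmonic: function_ring_on circle_harmonic "sphere 0 1"
  proof unfold_locales
    fix x y :: complex assume xy: "x \<noteq> y"
    have "Re \<in> circle_harmonic" "Im \<in> circle_harmonic"
      by (rule circle_harmonicI[of _ "[:0,1:]"], simp, rule circle_harmonicI[of _ "[:0,-\<i>:]"], simp)
    moreover have "Re x \<noteq> Re y \<or> Im x \<noteq> Im y" using xy complex_eqI by blast
    ultimately show "\<exists>f\<in>circle_harmonic. f x \<noteq> f y" by (elim disjE) (rule bexI; assumption)+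
  next
    show "(\<lambda>_. c) \<in> circle_harmonic" for c
      by (rule circle_harmonicI[of _ "[:of_real c:]"]) simp
  qed (auto simp: circle_harmonic_add circle_harmonic_mult, auto simp: circle_harmonic_def)
  obtain g where g: "g \<in> circle_harmonic" "\<forall>z\<in>sphere 0 1. \<bar>u z - g z\<bar> < e"
    using circle_harmonic.Stone_Weierstrass_basic[OF assms] by blast
  then obtain p where p: "\<forall>z\<in>sphere 0 1. g z = Re (poly p z)" by (auto simp: circle_harmonic_def)
  show ?thesis
  proof (rule that[of "\<lambda>z. poly p z - \<i> * of_real (Im (poly p 0))"])
    show "(\<lambda>z. poly p z - \<i> * of_real (Im (poly p 0))) holomorphic_on UNIV"
      by (intro holomorphic_intros)
  qed (use g p in auto)
qed

lemma circle_upper_approx: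
  assumes "continuous_on (sphere 0 1) u" "e > 0"
  obtains Q where "Q holomorphic_on UNIV" "Im (Q 0) = 0"
    "\<And>z. cmod z = 1 \<Longrightarrow> u z < Re (Q z)" "\<And>z. cmod z = 1 \<Longrightarrow> Re (Q z) < u z + e"
proof -
  have "continuous_on (sphere 0 1) (\<lambda>z. u z + e / 2)"
    using assms by (intro continuous_intros) auto
  then obtain Q where Q: "Q holomorphic_on UNIV" "Im (Q 0) = 0"
      "\<And>z. cmod z = 1 \<Longrightarrow> \<bar>(u z + e/2) - Re (Q z)\<bar> < e / 2"
    using circle_approx_Re_entire[of "\<lambda>z. u z + e / 2" "e/2"] assms by auto
  show ?thesis
  proof (rule that[OF Q(1,2)])
    fix z :: complex assume "cmod z = 1"
    from Q(3)[OF this] show "u z < Re (Q z)" "Re (Q z) < u z + e" unfolding abs_less_iff by auto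
  qed
qed

lemma maximum_modulus_disk:
  assumes "continuous_on (cball 0 1) f" "f holomorphic_on ball 0 1"
    and "\<And>z. cmod z = 1 \<Longrightarrow> cmod (f z) \<le> B" "cmod z \<le> 1"
  shows "cmod (f z) \<le> B"
  using maximum_modulus_frontier[of f "cball 0 1" B z] assms
  by (auto simp: interior_cball dist_norm)

lemma entire_continuous_on: "Q holomorphic_on UNIV \<Longrightarrow> continuous_on S Q" for Q :: "complex \<Rightarrow> complex"
  using continuous_on_subset holomorphic_on_imp_continuous_on by blast

text \<open>Two uses of the maximum modulus principle. Approximating \<open>ln \<bar>g\<bar>\<close>, made finite
  at the zeros of \<open>g\<close> by the summand \<open>e / 2\<close>, on the circle from above by \<open>Re R\<close> gives a zero-free function \<open>exp R\<close> that dominates \<open>g\<close> on the circle, hence in the disk,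
  because \<open>g / exp R\<close> is holomorphic. So zeros of \<open>g\<close> need no separate treatment, and
  \<open>\<bar>exp R\<bar> powr p\<close> is the modulus of the holomorphic function \<open>exp (p R)\<close>. Approximating this
  modulus on the circle from above by \<open>Re Q\<close> gives \<open>Re (l * exp (p R) - Q) \<le> 0\<close> on the circle for
  every unimodular \<open>l\<close>, hence in the disk.\<close>

lemma harmonic_majorant:
  fixes g :: "complex \<Rightarrow> complex"
  assumes cont: "continuous_on (cball 0 1) g" and hol: "g holomorphic_on ball 0 1"
    and p: "p > 0" and e: "e > 0"
  obtains Q where "Q holomorphic_on UNIV" "Im (Q 0) = 0"
    "\<And>z. cmod z \<le> 1 \<Longrightarrow> 0 < Re (Q z)"
    "\<And>z. cmod z \<le> 1 \<Longrightarrow> cmod (g z) powr p \<le> Re (Q z)"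
    "\<And>z. cmod z = 1 \<Longrightarrow> Re (Q z) \<le> cmod (g z) powr p + e"
proof -
  define u where "u z = ln (cmod (g z) powr p + e / 2) / p" for z
  have gp: "continuous_on (sphere 0 1) (\<lambda>z. cmod (g z) powr p)"
    by (rule continuous_on_powr') (auto intro!: continuous_intros continuous_on_subset[OF cont] simp: p)
  have pos: "cmod (g z) powr p + e / 2 > 0" for z using e by (simp add: add_nonneg_pos)
  have cu: "continuous_on (sphere 0 1) u"
    unfolding u_def using p pos by (intro continuous_intros gp) (auto simp: less_imp_neq[THEN not_sym])
  \<comment> \<open>the margin is chosen so that the exponential changes by less than what is left of \<open>e\<close>\<close>
  have "bounded ((\<lambda>z. cmod (g z) powr p) ` sphere 0 1)"
    by (intro compact_imp_bounded compact_continuous_image gp) auto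
  then obtain M where M: "M > 0" "\<And>z. cmod z = 1 \<Longrightarrow> cmod (g z) powr p \<le> M"
    unfolding bounded_pos by force
  define d where "d = ln (1 + e / (4 * (M + e))) / p"
  have d: "d > 0" unfolding d_def using e M p by (intro divide_pos_pos ln_gt_zero) auto
  obtain R where R: "R holomorphic_on UNIV"
      "\<And>z. cmod z = 1 \<Longrightarrow> u z < Re (R z)" "\<And>z. cmod z = 1 \<Longrightarrow> Re (R z) < u z + d"
    using circle_upper_approx[OF cu d] by metis
  have expu: "exp (p * u z) = cmod (g z) powr p + e / 2" for z
    unfolding u_def using p pos[of z] by simp
  have Rlow: "cmod (g z) powr p + e/2 \<le> exp (p * Re (R z))" if "cmod z = 1" for z
    using R(2)[OF that] p by (subst expu[symmetric]) simp
  have Rup: "exp (p * Re (R z)) \<le> cmod (g z) powr p + 3/4 * e" if z: "cmod z = 1" for z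
  proof -
    have "exp (p * Re (R z)) \<le> exp (p * u z + p * d)"
      using R(3)[OF z] p by (simp add: distrib_left[symmetric])
    also have "\<dots> = (cmod (g z) powr p + e / 2) * (1 + e / (4 * (M + e)))"
      using M e p by (simp add: exp_add expu d_def add_pos_pos)
    also have "\<dots> = cmod (g z) powr p + e / 2 + (cmod (g z) powr p + e / 2) * (e / (4 * (M + e)))"
      by (simp add: algebra_simps)
    also have "\<dots> \<le> cmod (g z) powr p + e / 2 + (M + e) * (e / (4 * (M + e)))"
      using M(1) M(2)[OF z] e by (intro add_left_mono mult_right_mono) auto
    also have "\<dots> = cmod (g z) powr p + 3/4 * e"
      using M e by (simp add: field_simps)
    finally show ?thesis .
  qed
  have gle: "cmod (g z) powr p \<le> exp (p * Re (R z))" if z: "cmod z \<le> 1" for z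
  proof -
    have nrm: "cmod (g w * exp (- R w)) \<le> 1 \<longleftrightarrow> cmod (g w) \<le> exp (Re (R w))" for w
      by (simp add: norm_divide exp_minus divide_le_eq flip: divide_inverse)
    have "cmod (g z * exp (- R z)) \<le> 1"
    proof (rule maximum_modulus_disk[OF _ _ _ z])
      show "continuous_on (cball 0 1) (\<lambda>z. g z * exp (- R z))"
        by (intro continuous_intros entire_continuous_on R(1) cont)
      show "(\<lambda>z. g z * exp (- R z)) holomorphic_on ball 0 1"
        using R(1) hol by (intro holomorphic_intros) (auto intro: holomorphic_on_subset)
    next
      fix w :: complex assume w: "cmod w = 1"
      have "cmod (g w) powr p \<le> exp (p * Re (R w))" using Rlow[OF w] e by simp
      also have "\<dots> = exp (Re (R w)) powr p" by (simp add: powr_def)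
      finally have "cmod (g w) \<le> exp (Re (R w))"
        using p powr_less_mono2[of p "exp (Re (R w))" "cmod (g w)"] by (meson exp_ge_zero not_le)
      then show "cmod (g w * exp (- R w)) \<le> 1"
        by (simp add: nrm)
    qed
    then have "cmod (g z) \<le> exp (Re (R z))" by (simp add: nrm)
    then have "cmod (g z) powr p \<le> exp (Re (R z)) powr p" using p by (intro powr_mono2) auto
    also have "\<dots> = exp (p * Re (R z))" by (simp add: powr_def)
    finally show ?thesis .
  qed
  have cR: "continuous_on (sphere 0 1) (\<lambda>z. exp (p * Re (R z)))"
    by (intro continuous_intros entire_continuous_on R(1))
  have e4: "e / 4 > 0" using e by simp
  obtain Q where Q: "Q holomorphic_on UNIV" "Im (Q 0) = 0"
     "\<And>z. cmod z = 1 \<Longrightarrow> exp (p * Re (R z)) < Re (Q z)"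
     "\<And>z. cmod z = 1 \<Longrightarrow> Re (Q z) < exp (p * Re (R z)) + e / 4"
    using circle_upper_approx[OF cR e4] by metis
  have ge: "exp (p * Re (R z)) \<le> Re (Q z)" if z: "cmod z \<le> 1" for z
  proof -
    \<comment> \<open>the rotation that makes \<open>l * exp (p R)\<close> positive at \<open>z\<close>\<close>
    define l where "l = exp (- (\<i> * of_real (p * Im (R z))))"
    have l: "cmod l = 1" unfolding l_def by (simp add: norm_exp_eq_Re)
    have "- (\<i> * of_real (p * Im (R z))) + of_real p * R z = of_real (p * Re (R z))"
      by (simp add: complex_eq_iff)
    then have lz: "l * exp (of_real p * R z) = of_real (exp (p * Re (R z)))"
      unfolding l_def by (simp only: exp_add[symmetric] exp_of_real)
    have "cmod (exp (l * exp (of_real p * R z) - Q z)) \<le> 1"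
    proof (rule maximum_modulus_disk[OF _ _ _ z])
      show "continuous_on (cball 0 1) (\<lambda>z. exp (l * exp (of_real p * R z) - Q z))"
        using R(1) Q(1) by (intro continuous_intros entire_continuous_on)
      show "(\<lambda>z. exp (l * exp (of_real p * R z) - Q z)) holomorphic_on ball 0 1"
        using R(1) Q(1) by (intro holomorphic_intros) (auto intro: holomorphic_on_subset)
    next
      fix w :: complex assume w: "cmod w = 1"
      have "Re (l * exp (of_real p * R w)) \<le> cmod (l * exp (of_real p * R w))"
        by (rule complex_Re_le_cmod)
      also have "\<dots> = exp (p * Re (R w))" by (simp add: norm_mult l)
      also have "\<dots> \<le> Re (Q w)" using Q(3)[OF w] by simp
      finally show "cmod (exp (l * exp (of_real p * R w) - Q w)) \<le> 1" by simp
    qed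
    then have "Re (l * exp (of_real p * R z) - Q z) \<le> 0" by simp
    then show ?thesis unfolding lz by simp
  qed
  show ?thesis
  proof (rule that[OF Q(1,2)])
    show "0 < Re (Q z)" if "cmod z \<le> 1" for z
      using ge[OF that] by (rule less_le_trans[OF exp_gt_zero])
    show "cmod (g z) powr p \<le> Re (Q z)" if "cmod z \<le> 1" for z
      using gle[OF that] ge[OF that] by simp
    show "Re (Q z) \<le> cmod (g z) powr p + e" if "cmod z = 1" for z
      using Q(4)[OF that] Rup[OF that] by simp
  qed
qed

section \<open>Hardy spaces and composition\<close>

text \<open>The Schwarz lemma for the Cayley transform of \<open>Q\<close>.\<close>

lemma Harnack_disk:
  assumes hol: "Q holomorphic_on ball 0 1" and im: "Im (Q 0) = 0"
    and pos: "\<And>z. cmod z < 1 \<Longrightarrow> 0 < Re (Q z)" and a: "cmod a < 1"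
  shows "Re (Q a) \<le> (1 + cmod a) / (1 - cmod a) * Re (Q 0)"
proof -
  define q where "q = Re (Q 0)"
  have q: "q > 0" using pos[of 0] by (simp add: q_def)
  have Q0: "Q 0 = of_real q" using im by (simp add: q_def complex_eq_iff)
  have nz: "Q z + of_real q \<noteq> 0" if "cmod z < 1" for z
    using pos[OF that] q by (auto simp: complex_eq_iff)
  define F where "F z = (Q z - of_real q) / (Q z + of_real q)" for z
  have "F holomorphic_on ball 0 1"
    unfolding F_def by (intro holomorphic_intros hol) (use nz in auto)
  moreover have "F 0 = 0" by (simp add: F_def Q0)
  moreover have "cmod (F z) < 1" if z: "cmod z < 1" for z
  proof -
    have "(cmod (Q z - of_real q))\<^sup>2 < (cmod (Q z + of_real q))\<^sup>2"
      using pos[OF z] q by (simp add: cmod_power2 power2_sum power2_diff)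
    then have "cmod (Q z - of_real q) < cmod (Q z + of_real q)"
      by (rule power_less_imp_less_base) simp
    then show ?thesis using nz[OF z] by (simp add: F_def norm_divide)
  qed
  ultimately have "cmod (F a) \<le> cmod a" using a by (rule Schwarz_Lemma)
  then have "cmod (Q a - of_real q) \<le> cmod a * cmod (Q a + of_real q)"
    using nz[OF a] by (simp add: F_def norm_divide divide_le_eq)
  also have "\<dots> \<le> cmod a * (cmod (Q a) + q)"
    using q by (intro mult_left_mono) (auto intro: order_trans[OF norm_triangle_ineq])
  finally have "cmod (Q a) - q \<le> cmod a * (cmod (Q a) + q)"
    using norm_triangle_ineq2[of "Q a" "of_real q"] q by simp
  then have "cmod (Q a) * (1 - cmod a) \<le> q * (1 + cmod a)" by (simp add: algebra_simps)
  then have "cmod (Q a) \<le> q * (1 + cmod a) / (1 - cmod a)" using a by (simp add: pos_le_divide_eq)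
  then show ?thesis using complex_Re_le_cmod[of "Q a"] by (simp add: q_def mult_ac)
qed

lemma continuous_on_norm_powr:
  assumes "continuous_on S f" "p > 0"
  shows "continuous_on S (\<lambda>z. norm (f z) powr p)"
  by (rule continuous_on_powr') (use assms in \<open>auto intro!: continuous_intros\<close>)

lemma dilation_in_disk:
  assumes "0 < r" "r < 1" "cmod z \<le> 1"
  shows "cmod (of_real r * z) < 1"
proof -
  have "r * cmod z \<le> r * 1" using assms by (intro mult_left_mono) auto
  also have "\<dots> < 1" using assms by simp
  finally show ?thesis using assms by (simp add: norm_mult)
qed

lemma continuous_on_dilated_circle:
  assumes "continuous_on (ball 0 1) f" "0 < r" "r < 1"
  shows "continuous_on (sphere 0 1) (\<lambda>z::complex. f (of_real r * z))"
  by (rule continuous_on_compose2[OF assms(1)]) (use assms in \<open>auto intro!: continuous_intros simp: norm_mult\<close>)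

text \<open>The Harnack constant at the point \<open>\<phi> 0\<close>.\<close>

definition subordination_const :: "(complex \<Rightarrow> complex) \<Rightarrow> real" where
  "subordination_const \<phi> = (1 + cmod (\<phi> 0)) / (1 - cmod (\<phi> 0))"

lemma holomorphic_self_mapD:
  assumes "holomorphic_self_map \<phi>"
  shows "\<phi> holomorphic_on ball 0 1" "cmod z < 1 \<Longrightarrow> cmod (\<phi> z) < 1"
  using assms by (auto simp: holomorphic_self_map_def image_subset_iff)

lemma subordination_const_ge_1: "holomorphic_self_map \<phi> \<Longrightarrow> 1 \<le> subordination_const \<phi>"
  using holomorphic_self_mapD(2)[of \<phi> 0] by (simp add: subordination_const_def)

text \<open>The majorant \<open>Re Q\<close> of \<open>\<bar>g\<bar> powr p\<close> is harmonic, so the mean of \<open>Re Q \<circ> \<phi>\<close> over a circle about \<open>0\<close>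
  is its value \<open>Re (Q (\<phi> 0))\<close> at the centre, which Harnack's inequality compares with
  \<open>Re (Q 0)\<close>, that is, with the mean of \<open>\<bar>g\<bar> powr p\<close> up to \<open>\<epsilon>\<close>.\<close>

lemma Littlewood_subordination_closed_disk:
  assumes cont: "continuous_on (cball 0 1) g" and hol: "g holomorphic_on ball 0 1"
    and phi: "holomorphic_self_map \<phi>" and p: "p > 0" and r: "0 < r" "r < 1"
  shows "circle_mean (\<lambda>z. cmod (g (\<phi> (of_real r * z))) powr p)
       \<le> subordination_const \<phi> * circle_mean (\<lambda>z. cmod (g z) powr p)"
proof -
  define C where "C = subordination_const \<phi>"
  have C: "C \<ge> 1" unfolding C_def by (rule subordination_const_ge_1[OF phi])
  note phiD = holomorphic_self_mapD[OF phi]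
  have phir: "cmod (\<phi> (of_real r * z)) < 1" if "cmod z \<le> 1" for z
    by (rule phiD(2)[OF dilation_in_disk[OF r that]])
  have cphir: "continuous_on (cball 0 1) (\<lambda>z. \<phi> (of_real r * z))"
  proof (rule continuous_on_compose2[of "ball 0 1" \<phi>])
    show "(\<lambda>z. complex_of_real r * z) ` cball 0 1 \<subseteq> ball 0 1"
      using dilation_in_disk[OF r] by auto
  qed (auto intro!: continuous_intros holomorphic_on_imp_continuous_on phiD)
  have "circle_mean (\<lambda>z. cmod (g (\<phi> (of_real r * z))) powr p) \<le> C * circle_mean (\<lambda>z. cmod (g z) powr p) + e"
    if e: "e > 0" for e
  proof -
    have eC: "e / C > 0" using e C by simp
    obtain Q where Q: "Q holomorphic_on UNIV" "Im (Q 0) = 0"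
      "\<And>z. cmod z \<le> 1 \<Longrightarrow> 0 < Re (Q z)"
      "\<And>z. cmod z \<le> 1 \<Longrightarrow> cmod (g z) powr p \<le> Re (Q z)"
      "\<And>z. cmod z = 1 \<Longrightarrow> Re (Q z) \<le> cmod (g z) powr p + e / C"
      using harmonic_majorant[OF cont hol p eC] by metis
    have c1: "continuous_on (cball 0 1) (\<lambda>z. Q (\<phi> (of_real r * z)))"
      by (rule continuous_on_compose2[OF entire_continuous_on[OF Q(1)] cphir]) auto
    have h1: "(\<lambda>z. Q (\<phi> (of_real r * z))) holomorphic_on ball 0 1"
    proof -
      have "\<phi> \<circ> (\<lambda>z. of_real r * z) holomorphic_on ball 0 1"
        by (rule holomorphic_on_compose_gen[OF _ phiD(1)])
           (use dilation_in_disk[OF r] in \<open>auto intro!: holomorphic_intros simp: less_imp_le\<close>)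
      from holomorphic_on_compose_gen[OF this Q(1)] show ?thesis by (simp add: o_def)
    qed
    have sub: "continuous_on (sphere 0 1) F" if "continuous_on (cball 0 1) F" for F :: "complex \<Rightarrow> complex"
      using that by (rule continuous_on_subset) auto
    have cg: "continuous_on (sphere 0 1) (\<lambda>z. cmod (g z) powr p)"
      by (rule continuous_on_norm_powr[OF sub[OF cont] p])
    have cgp: "continuous_on (cball 0 1) (\<lambda>z. g (\<phi> (of_real r * z)))"
      by (rule continuous_on_compose2[OF cont cphir]) (use phir in \<open>auto simp: less_imp_le\<close>)
    have "circle_mean (\<lambda>z. cmod (g (\<phi> (of_real r * z))) powr p)
        \<le> circle_mean (\<lambda>z. Re (Q (\<phi> (of_real r * z))))"
      by (intro circle_mean_mono continuous_on_norm_powr continuous_on_Re sub c1 cgp p)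
         (use Q(4) phir in \<open>auto simp: less_imp_le\<close>)
    also have "\<dots> = Re (Q (\<phi> 0))"
      using circle_mean_Re[OF sub[OF c1]] circle_mean_holomorphic[OF c1 h1] by simp
    also have "\<dots> \<le> C * Re (Q 0)"
      unfolding C_def subordination_const_def
      by (rule Harnack_disk) (use Q phiD(2)[of 0] in \<open>auto intro: holomorphic_on_subset\<close>)
    also have "Re (Q 0) = circle_mean (\<lambda>z. Re (Q z))"
      using circle_mean_Re[OF entire_continuous_on[OF Q(1)]]
        circle_mean_holomorphic[OF entire_continuous_on[OF Q(1)] holomorphic_on_subset[OF Q(1)]] by simp
    also have "C * circle_mean (\<lambda>z. Re (Q z)) \<le> C * circle_mean (\<lambda>z. cmod (g z) powr p + e / C)"
      using C by (intro mult_left_mono circle_mean_mono continuous_intros cg entire_continuous_on Q) auto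
    also have "circle_mean (\<lambda>z. cmod (g z) powr p + e / C) = circle_mean (\<lambda>z. cmod (g z) powr p) + e / C"
      by (subst circle_mean_add) (auto intro: cg)
    also have "C * (circle_mean (\<lambda>z. cmod (g z) powr p) + e / C) = C * circle_mean (\<lambda>z. cmod (g z) powr p) + e"
      using C by (simp add: field_simps)
    finally show ?thesis .
  qed
  then show ?thesis unfolding C_def by (rule field_le_epsilon)
qed

lemma hardy_power_le_iff:
  assumes "f holomorphic_on ball 0 1" "p > 0" "0 \<le> B"
  shows "hardy_power p f \<le> ennreal B \<longleftrightarrow>
    (\<forall>r. 0 < r \<longrightarrow> r < 1 \<longrightarrow> circle_mean (\<lambda>z. cmod (f (of_real r * z)) powr p) \<le> B)"
proof -
  have "(\<integral>\<^sup>+ z. ennreal (cmod (f (of_real r * z)) powr p) \<partial>circle_measure)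
      = ennreal (circle_mean (\<lambda>z. cmod (f (of_real r * z)) powr p))" if "0 < r" "r < 1" for r
    using that assms
    by (intro nn_integral_circle_measure continuous_on_norm_powr continuous_on_dilated_circle
         holomorphic_on_imp_continuous_on) auto
  then show ?thesis unfolding hardy_power_def SUP_le_iff using assms(3) by auto
qed

lemma hardy_power_cong:
  assumes "\<And>z. cmod z < 1 \<Longrightarrow> cmod (f z) = cmod (g z)"
  shows "hardy_power p f = hardy_power p g"
  unfolding hardy_power_def
proof (intro SUP_cong refl nn_integral_cong_AE)
  fix r :: real assume "r \<in> {0<..<1}"
  show "AE z in circle_measure. ennreal (cmod (f (of_real r * z)) powr p) = ennreal (cmod (g (of_real r * z)) powr p)"
    by (rule eventually_mono[OF AE_circle_measure]) (use \<open>r \<in> {0<..<1}\<close> in \<open>simp add: assms norm_mult\<close>)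
qed

text \<open>Lower semicontinuity under pointwise convergence; it is used to pass from the dilates of a
  function to the function and to see that limits stay in the unit ball.\<close>

lemma hardy_power_Fatou:
  assumes hf: "\<And>n. f n holomorphic_on ball 0 1" and hg: "g holomorphic_on ball 0 1"
    and lim: "\<And>z. cmod z < 1 \<Longrightarrow> (\<lambda>n. f n z) \<longlonglongrightarrow> g z"
    and le: "\<And>n. hardy_power p (f n) \<le> B" and p: "p > 0"
  shows "hardy_power p g \<le> B"
proof -
  have "(\<integral>\<^sup>+ z. ennreal (cmod (g (of_real r * z)) powr p) \<partial>circle_measure) \<le> B" if r: "0 < r" "r < 1" for r
  proof -
    \<comment> \<open>truncation makes the functions Borel measurable on the whole plane\<close>
    define tr where "tr F z = indicator (ball 0 1) z *\<^sub>R F z" for F :: "complex \<Rightarrow> complex" and z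
    have tr: "tr F \<in> borel_measurable borel" if "F holomorphic_on ball 0 1" for F
      unfolding tr_def
      by (rule borel_measurable_continuous_on_indicator[OF _ holomorphic_on_imp_continuous_on[OF that]]) auto
    note [measurable] = tr[OF hf] tr[OF hg]
    have eq: "(\<integral>\<^sup>+ z. ennreal (cmod (F (of_real r * z)) powr p) \<partial>circle_measure)
        = (\<integral>\<^sup>+ z. ennreal (cmod (tr F (of_real r * z)) powr p) \<partial>circle_measure)" for F
    proof (rule nn_integral_cong_AE)
      show "AE z in circle_measure. ennreal (cmod (F (of_real r * z)) powr p) = ennreal (cmod (tr F (of_real r * z)) powr p)"
        by (rule eventually_mono[OF AE_circle_measure]) (use r in \<open>simp add: tr_def norm_mult\<close>)
    qed
    have "(\<integral>\<^sup>+ z. ennreal (cmod (tr g (of_real r * z)) powr p) \<partial>circle_measure)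
        = (\<integral>\<^sup>+ z. liminf (\<lambda>n. ennreal (cmod (tr (f n) (of_real r * z)) powr p)) \<partial>circle_measure)"
    proof (rule nn_integral_cong)
      fix z
      have "(\<lambda>n. tr (f n) (of_real r * z)) \<longlonglongrightarrow> tr g (of_real r * z)"
        unfolding tr_def using lim[of "of_real r * z"] by (auto simp: indicator_def)
      then have "(\<lambda>n. ennreal (cmod (tr (f n) (of_real r * z)) powr p)) \<longlonglongrightarrow> ennreal (cmod (tr g (of_real r * z)) powr p)"
        by (intro tendsto_intros tendsto_ennrealI) (use p in auto)
      then show "ennreal (cmod (tr g (of_real r * z)) powr p) = liminf (\<lambda>n. ennreal (cmod (tr (f n) (of_real r * z)) powr p))"
        by (rule lim_imp_Liminf[OF trivial_limit_sequentially, symmetric])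
    qed
    also have "\<dots> \<le> liminf (\<lambda>n. \<integral>\<^sup>+ z. ennreal (cmod (tr (f n) (of_real r * z)) powr p) \<partial>circle_measure)"
      by (rule nn_integral_liminf) measurable
    also have "\<dots> \<le> B"
    proof -
      have "(\<integral>\<^sup>+ z. ennreal (cmod (tr (f n) (of_real r * z)) powr p) \<partial>circle_measure) \<le> B" for n
        using le[of n] r unfolding hardy_power_def SUP_le_iff eq[symmetric] by auto
      then have "liminf (\<lambda>n. \<integral>\<^sup>+ z. ennreal (cmod (tr (f n) (of_real r * z)) powr p) \<partial>circle_measure)
         \<le> liminf (\<lambda>n::nat. B)" by (intro Liminf_mono) auto
      then show ?thesis by (simp add: Liminf_const)
    qed
    finally show ?thesis by (subst eq)
  qed
  then show ?thesis unfolding hardy_power_def SUP_le_iff by auto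
qed

lemma dilation_tendsto:
  assumes hol: "f holomorphic_on ball 0 1" and z: "cmod z < 1"
  shows "(\<lambda>n. f (of_real (1 - 1 / real (n + 2)) * z)) \<longlonglongrightarrow> f z"
proof -
  have "(\<lambda>n. 1 / real (n + 2)) \<longlonglongrightarrow> 0"
    using LIMSEQ_ignore_initial_segment[OF lim_1_over_n, of 2] by (simp add: add.commute)
  then have "(\<lambda>n. complex_of_real (1 - 1 / real (n + 2)) * z) \<longlonglongrightarrow> of_real (1 - 0) * z"
    by (intro tendsto_intros)
  moreover have "isCont f z"
    using hol z by (intro continuous_on_interior[OF holomorphic_on_imp_continuous_on]) (auto simp: interior_open)
  ultimately show ?thesis using isCont_tendsto_compose by fastforce
qed

lemma dilation_holomorphic:
  assumes hol: "f holomorphic_on ball 0 1" and r: "0 < r" "r < 1"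
  shows "continuous_on (cball 0 1) (\<lambda>z. f (of_real r * z))" "(\<lambda>z. f (of_real r * z)) holomorphic_on ball 0 1"
proof -
  note * = dilation_in_disk[OF r]
  show "continuous_on (cball 0 1) (\<lambda>z. f (of_real r * z))"
    by (rule continuous_on_compose2[OF holomorphic_on_imp_continuous_on[OF hol]]) 
       (use * in \<open>auto intro!: continuous_intros\<close>)
  have "f \<circ> (\<lambda>z. of_real r * z) holomorphic_on ball 0 1"
    by (rule holomorphic_on_compose_gen[OF _ hol]) (use * in \<open>auto intro!: holomorphic_intros\<close>)
  then show "(\<lambda>z. f (of_real r * z)) holomorphic_on ball 0 1" by (simp add: o_def)
qed

lemma comp_op_holomorphic:
  assumes "f holomorphic_on ball 0 1" "holomorphic_self_map \<phi>"
  shows "comp_op \<phi> f holomorphic_on ball 0 1"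
proof -
  have "f \<circ> \<phi> holomorphic_on ball 0 1"
    using holomorphic_on_compose_gen[of \<phi> "ball 0 1" f "ball 0 1"] assms by (auto simp: holomorphic_self_map_def)
  then show ?thesis by (rule holomorphic_transform) (auto simp: comp_op_def)
qed

lemma Littlewood_subordination:
  assumes hol: "f holomorphic_on ball 0 1" and phi: "holomorphic_self_map \<phi>" and p: "p > 0"
    and B: "hardy_power p f \<le> ennreal B" "B \<ge> 0"
  shows "hardy_power p (comp_op \<phi> f) \<le> ennreal (subordination_const \<phi> * B)"
proof -
  define r where "r n = 1 - 1 / real (n + 2)" for n
  have r: "0 < r n" "r n < 1" for n unfolding r_def by (auto simp: field_simps)
  have C: "subordination_const \<phi> \<ge> 1" by (rule subordination_const_ge_1[OF phi])
  note phiD = holomorphic_self_mapD[OF phi]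
  show ?thesis
  proof (rule hardy_power_Fatou[where f = "\<lambda>n. comp_op \<phi> (\<lambda>z. f (of_real (r n) * z))"])
    show "(\<lambda>n. comp_op \<phi> (\<lambda>z. f (of_real (r n) * z)) z) \<longlonglongrightarrow> comp_op \<phi> f z" if "cmod z < 1" for z
      using dilation_tendsto[OF hol phiD(2)[OF that]] that by (simp add: comp_op_def r_def)
    fix n
    show hn: "comp_op \<phi> (\<lambda>z. f (of_real (r n) * z)) holomorphic_on ball 0 1"
      by (rule comp_op_holomorphic[OF dilation_holomorphic(2)[OF hol r] phi])
    show "hardy_power p (comp_op \<phi> (\<lambda>z. f (of_real (r n) * z))) \<le> ennreal (subordination_const \<phi> * B)"
    proof (subst hardy_power_le_iff[OF hn p], use C B in simp, safe)
      fix s :: real assume s: "0 < s" "s < 1"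
      have "circle_mean (\<lambda>z. cmod (comp_op \<phi> (\<lambda>z. f (of_real (r n) * z)) (of_real s * z)) powr p)
         = circle_mean (\<lambda>z. cmod (f (of_real (r n) * \<phi> (of_real s * z))) powr p)"
        by (rule circle_mean_cong) (use s in \<open>auto simp: comp_op_def norm_mult\<close>)
      also have "\<dots> \<le> subordination_const \<phi> * circle_mean (\<lambda>z. cmod (f (of_real (r n) * z)) powr p)"
        by (rule Littlewood_subordination_closed_disk[OF dilation_holomorphic[OF hol r] phi p s])
      also have "\<dots> \<le> subordination_const \<phi> * B"
        using B r C by (intro mult_left_mono) (auto simp: hardy_power_le_iff[OF hol p])
      finally show "circle_mean (\<lambda>z. cmod (comp_op \<phi> (\<lambda>z. f (of_real (r n) * z)) (of_real s * z)) powr p)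
          \<le> subordination_const \<phi> * B" .
    qed
  qed (use comp_op_holomorphic[OF hol phi] p in auto)
qed

text \<open>Littlewood subordination for the constant map with value \<open>a\<close>.\<close>

lemma hardy_growth:
  assumes hol: "f holomorphic_on ball 0 1" and p: "p > 0"
    and B: "hardy_power p f \<le> ennreal B" "B \<ge> 0" and a: "cmod a < 1"
  shows "cmod (f a) powr p \<le> (1 + cmod a) / (1 - cmod a) * B"
proof -
  have phi: "holomorphic_self_map (\<lambda>_. a)" using a by (auto simp: holomorphic_self_map_def)
  have C: "subordination_const (\<lambda>_. a) \<ge> 1" by (rule subordination_const_ge_1[OF phi])
  have "circle_mean (\<lambda>z. cmod (comp_op (\<lambda>_. a) f (of_real (1/2) * z)) powr p) \<le> subordination_const (\<lambda>_. a) * B"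
    using Littlewood_subordination[OF hol phi p B] C B
    by (subst (asm) hardy_power_le_iff[OF comp_op_holomorphic[OF hol phi] p])
       (auto dest!: spec[of _ "1/2"])
  moreover have "circle_mean (\<lambda>z. cmod (comp_op (\<lambda>_. a) f (of_real (1/2) * z)) powr p)
     = circle_mean (\<lambda>z. cmod (f a) powr p)"
    by (rule circle_mean_cong) (auto simp: comp_op_def norm_mult)
  ultimately show ?thesis by (simp add: subordination_const_def)
qed

text \<open>Let \<open>Re Q\<close> majorize \<open>\<bar>g\<bar> powr (q / 2)\<close> and \<open>W = Q + 1\<close>. The \<open>H\<^sup>2\<close> bound is the elementary case of the
  conjugate function theorem: the mean of \<open>W\<^sup>2\<close> is \<open>(W 0)\<^sup>2 \<ge> 0\<close>, so the mean of \<open>(Im W)\<^sup>2\<close> is at most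
  that of \<open>(Re W)\<^sup>2\<close>.\<close>

lemma half_plane_majorant:
  fixes g :: "complex \<Rightarrow> complex"
  assumes cont: "continuous_on (cball 0 1) g" and hol: "g holomorphic_on ball 0 1" and q: "q > 0"
  obtains W where "W holomorphic_on UNIV" "\<And>z. cmod z \<le> 1 \<Longrightarrow> 1 \<le> Re (W z)"
    "\<And>z. cmod z \<le> 1 \<Longrightarrow> cmod (g z) \<le> cmod (W z) powr (2 / q)"
    "circle_mean (\<lambda>z. (cmod (W z))\<^sup>2) \<le> 4 * circle_mean (\<lambda>z. cmod (g z) powr q) + 16"
proof -
  obtain Q where Q: "Q holomorphic_on UNIV" "Im (Q 0) = 0"
      "\<And>z. cmod z \<le> 1 \<Longrightarrow> 0 < Re (Q z)"
      "\<And>z. cmod z \<le> 1 \<Longrightarrow> cmod (g z) powr (q / 2) \<le> Re (Q z)"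
      "\<And>z. cmod z = 1 \<Longrightarrow> Re (Q z) \<le> cmod (g z) powr (q / 2) + 1"
    using harmonic_majorant[OF cont hol half_gt_zero[OF q] zero_less_one] by metis
  define W where "W z = Q z + 1" for z
  have W: "W holomorphic_on UNIV" unfolding W_def by (intro holomorphic_intros Q)
  note cW = entire_continuous_on[OF W]
  have cg: "continuous_on (sphere 0 1) (\<lambda>z. cmod (g z) powr q)"
    by (rule continuous_on_norm_powr[OF continuous_on_subset[OF cont] q]) auto
  show ?thesis
  proof (rule that[OF W])
    fix z assume z: "cmod z \<le> 1"
    show "1 \<le> Re (W z)" using Q(3)[OF z] by (simp add: W_def)
    have "cmod (g z) powr (q / 2) \<le> cmod (W z)"
      using Q(4)[OF z] complex_Re_le_cmod[of "W z"] by (simp add: W_def)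
    then have "(cmod (g z) powr (q / 2)) powr (2 / q) \<le> cmod (W z) powr (2 / q)"
      using q by (intro powr_mono2) auto
    then show "cmod (g z) \<le> cmod (W z) powr (2 / q)" using q by (simp add: powr_powr)
  next
    have "circle_mean (\<lambda>z. (W z)\<^sup>2) = (W 0)\<^sup>2"
      by (rule circle_mean_holomorphic)
         (auto intro!: continuous_intros holomorphic_intros cW intro: holomorphic_on_subset[OF W])
    moreover have "Re (circle_mean (\<lambda>z. (W z)\<^sup>2)) = circle_mean (\<lambda>z. Re ((W z)\<^sup>2))"
      by (rule circle_mean_Re[symmetric]) (intro continuous_intros cW)
    moreover have "0 \<le> Re ((W 0)\<^sup>2)"
      using Q(2) by (simp add: W_def Re_power2)
    ultimately have pos: "0 \<le> circle_mean (\<lambda>z. Re ((W z)\<^sup>2))" by simp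
    have "circle_mean (\<lambda>z. (cmod (W z))\<^sup>2) \<le> circle_mean (\<lambda>z. (cmod (W z))\<^sup>2) + circle_mean (\<lambda>z. Re ((W z)\<^sup>2))"
      using pos by simp
    also have "\<dots> = circle_mean (\<lambda>z. (cmod (W z))\<^sup>2 + Re ((W z)\<^sup>2))"
      by (rule circle_mean_add[symmetric]; intro continuous_intros cW)
    also have "\<dots> \<le> circle_mean (\<lambda>z. 4 * cmod (g z) powr q + 16)"
    proof (rule circle_mean_mono)
      fix z :: complex assume z: "cmod z = 1"
      \<comment> \<open>adding \<open>Re (W\<^sup>2)\<close>, whose mean is nonnegative, removes the imaginary part\<close>
      have "(cmod (W z))\<^sup>2 + Re ((W z)\<^sup>2) = 2 * (Re (W z))\<^sup>2"
        by (simp add: cmod_power2 Re_power2)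
      also have "(Re (W z))\<^sup>2 \<le> (cmod (g z) powr (q / 2) + 2)\<^sup>2"
        using Q(5)[OF z] Q(3)[of z] z by (intro power_mono) (auto simp: W_def)
      also have "\<dots> \<le> 2 * (cmod (g z) powr (q / 2))\<^sup>2 + 2 * 2\<^sup>2"
        using sum_squares_bound[of "cmod (g z) powr (q / 2)" 2] by (simp add: power2_sum)
      also have "(cmod (g z) powr (q / 2))\<^sup>2 = cmod (g z) powr q"
        by (simp add: power2_eq_square flip: powr_add)
      finally show "(cmod (W z))\<^sup>2 + Re ((W z)\<^sup>2) \<le> 4 * cmod (g z) powr q + 16" by simp
    qed (intro continuous_intros cW cg)+
    also have "\<dots> = 4 * circle_mean (\<lambda>z. cmod (g z) powr q) + 16"
      by (subst circle_mean_add) (auto intro!: continuous_intros cg simp: circle_mean_cmult)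
    finally show "circle_mean (\<lambda>z. (cmod (W z))\<^sup>2) \<le> 4 * circle_mean (\<lambda>z. cmod (g z) powr q) + 16" .
  qed
qed

section \<open>A two-constants principle from normal families\<close>

text \<open>If no \<open>K\<close> works, then there are functions \<open>G\<^sub>n\<close>, bounded by \<open>C\<close>, that violate the inequality with
  \<open>K = n\<close>. Since \<open>\<bar>G\<^sub>n x0\<bar>\<close> is bounded, the values \<open>G\<^sub>n (s k)\<close> tend to \<open>0\<close> for each \<open>k\<close>, so a limit function
  given by Montel's theorem vanishes at all \<open>s k\<close>. These accumulate at a point of the domain, so
  the limit is \<open>0\<close>, although \<open>\<bar>G\<^sub>n x0\<bar> powr q\<close> stays above \<open>\<delta>\<close>.\<close>

lemma two_constants_normal_families:
  fixes \<Omega> :: "complex set" and s :: "nat \<Rightarrow> complex"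
  assumes \<Omega>: "open \<Omega>" "connected \<Omega>" and x: "x0 \<in> \<Omega>" "x1 \<in> \<Omega>"
    and s: "\<And>k. s k \<in> \<Omega>" "\<And>k. s k \<noteq> x1" "s \<longlonglongrightarrow> x1"
    and p: "p > 0" and q: "q > 0" and \<delta>: "\<delta> > 0"
  obtains K :: nat where "\<And>G. G holomorphic_on \<Omega> \<Longrightarrow> (\<And>z. z \<in> \<Omega> \<Longrightarrow> cmod (G z) \<le> C) \<Longrightarrow>
      cmod (G x0) powr q \<le> \<delta> + real K * (\<Sum>k<K. cmod (G (s k)) powr p)"
proof (rule ccontr)
  assume "\<not> thesis"
  have "\<exists>G. G holomorphic_on \<Omega> \<and> (\<forall>z\<in>\<Omega>. cmod (G z) \<le> C) \<and>
      cmod (G x0) powr q > \<delta> + real n * (\<Sum>k<n. cmod (G (s k)) powr p)" for n :: nat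
  proof (rule ccontr)
    assume "\<not> ?thesis"
    then have "thesis" by (intro that[of n]) (auto simp: not_less)
    with \<open>\<not> thesis\<close> show False by contradiction
  qed
  then have "\<exists>G. \<forall>n. G n holomorphic_on \<Omega> \<and> (\<forall>z\<in>\<Omega>. cmod (G n z) \<le> C) \<and>
      cmod (G n x0) powr q > \<delta> + real n * (\<Sum>k<n. cmod (G n (s k)) powr p)"
    by (intro choice allI)
  then obtain G where G: "\<And>n. G n holomorphic_on \<Omega>" "\<And>n z. z \<in> \<Omega> \<Longrightarrow> cmod (G n z) \<le> C"
      "\<And>n. cmod (G n x0) powr q > \<delta> + real n * (\<Sum>k<n. cmod (G n (s k)) powr p)"
    by blast
  define H where "H = {h. h holomorphic_on \<Omega> \<and> (\<forall>z\<in>\<Omega>. cmod (h z) \<le> C)}"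
  have H: "\<And>h. h \<in> H \<Longrightarrow> h holomorphic_on \<Omega>" "range G \<subseteq> H"
      "\<And>K. compact K \<Longrightarrow> K \<subseteq> \<Omega> \<Longrightarrow> \<exists>B. \<forall>h\<in>H. \<forall>z\<in>K. cmod (h z) \<le> B"
    using G(1,2) by (auto simp: H_def)
  have "\<exists>g r. g holomorphic_on \<Omega> \<and> strict_mono r \<and> (\<forall>z\<in>\<Omega>. (\<lambda>n. G (r n) z) \<longlonglongrightarrow> g z)"
  proof (rule Montel[OF \<Omega>(1) H(1,3,2)])
    fix g r assume "g holomorphic_on \<Omega>" "strict_mono (r :: nat \<Rightarrow> nat)"
      "\<And>z. z \<in> \<Omega> \<Longrightarrow> (\<lambda>n. G (r n) z) \<longlonglongrightarrow> g z"
    then show "\<exists>g r. g holomorphic_on \<Omega> \<and> strict_mono r \<and> (\<forall>z\<in>\<Omega>. (\<lambda>n. G (r n) z) \<longlonglongrightarrow> g z)"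
      by (intro exI[of _ g] exI[of _ r]) auto
  qed
  then obtain g r where g: "g holomorphic_on \<Omega>" "strict_mono r"
      "\<And>z. z \<in> \<Omega> \<Longrightarrow> (\<lambda>n. G (r n) z) \<longlonglongrightarrow> g z"
    by blast
  have "g (s k) = 0" for k
  proof -
    have lim: "(\<lambda>n. cmod (G (r n) (s k)) powr p) \<longlonglongrightarrow> cmod (g (s k)) powr p"
      by (intro tendsto_intros g s) (use p in auto)
    have null: "(\<lambda>n. C powr q / real n) \<longlonglongrightarrow> 0"
      by (rule lim_const_over_n)
    have "\<forall>\<^sub>F n in sequentially. cmod (G (r n) (s k)) powr p \<le> C powr q / real n"
    proof (rule eventually_sequentiallyI[of "Suc k"])
      fix n assume n: "Suc k \<le> n"
      have rn: "n \<le> r n" by (rule strict_mono_imp_increasing[OF g(2)])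
      have "real n * cmod (G (r n) (s k)) powr p \<le> real (r n) * (\<Sum>k<r n. cmod (G (r n) (s k)) powr p)"
        using rn n by (intro mult_mono member_le_sum) auto
      also have "\<dots> \<le> cmod (G (r n) x0) powr q" using G(3)[of "r n"] \<delta> by simp
      also have "\<dots> \<le> C powr q" using G(2)[OF x(1)] q by (intro powr_mono2) auto
      finally show "cmod (G (r n) (s k)) powr p \<le> C powr q / real n"
        using n by (simp add: field_simps)
    qed
    then have "cmod (g (s k)) powr p \<le> 0"
      by (rule tendsto_le[OF trivial_limit_sequentially null lim])
    then show ?thesis by simp
  qed
  moreover have "x1 islimpt range s"
    unfolding islimpt_sequential using s by (intro exI[of _ s]) simp
  ultimately have "g x0 = 0"
    using analytic_continuation[OF g(1) \<Omega>, of "range s" x1 x0] s x by auto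
  moreover have "\<delta> \<le> cmod (g x0) powr q"
  proof (rule tendsto_lowerbound)
    show "(\<lambda>n. cmod (G (r n) x0) powr q) \<longlonglongrightarrow> cmod (g x0) powr q"
      by (intro tendsto_intros g x) (use q in auto)
    show "\<forall>\<^sub>F n in sequentially. \<delta> \<le> cmod (G (r n) x0) powr q"
    proof (rule always_eventually, rule allI)
      fix n
      have "0 \<le> real (r n) * (\<Sum>k<r n. cmod (G (r n) (s k)) powr p)"
        by (intro mult_nonneg_nonneg sum_nonneg) auto
      then show "\<delta> \<le> cmod (G (r n) x0) powr q" using G(3)[of "r n"] by linarith
    qed
  qed simp
  ultimately show False using \<delta> by simp
qed

section \<open>Hardy spaces as metric spaces\<close>

lemma hardy_spaceD:
  assumes "f \<in> hardy_space p"
  shows "f holomorphic_on ball 0 1" "\<And>z. \<not> cmod z < 1 \<Longrightarrow> f z = 0" "hardy_power p f < \<infinity>"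
  using assms by (auto simp: hardy_space_def)

lemma hardy_spaceI:
  assumes "f holomorphic_on ball 0 1" "\<And>z. \<not> cmod z < 1 \<Longrightarrow> f z = 0" "hardy_power p f \<le> ennreal B"
  shows "f \<in> hardy_space p"
  using assms by (auto simp: hardy_space_def intro: le_less_trans)

text \<open>For \<open>p \<ge> 1\<close> this is the norm of \<open>H\<^sup>p\<close>, for \<open>p \<le> 1\<close> the \<open>p\<close>-th power of the quasi-norm. In both cases it
  is subadditive and therefore defines a metric.\<close>

definition hardy_pnorm :: "real \<Rightarrow> (complex \<Rightarrow> complex) \<Rightarrow> real" where
  "hardy_pnorm p f = enn2real (hardy_power p f) powr (1 / max 1 p)"

lemma hardy_pnorm_nonneg [simp]: "0 \<le> hardy_pnorm p f"
  by (simp add: hardy_pnorm_def)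

lemma hardy_power_eq_pnorm:
  assumes "f \<in> hardy_space p"
  shows "hardy_power p f = ennreal (hardy_pnorm p f powr (max 1 p))"
  using hardy_spaceD(3)[OF assms] by (simp add: hardy_pnorm_def powr_powr)

lemma hardy_pnorm_le_iff:
  assumes "f \<in> hardy_space p" "0 \<le> b"
  shows "hardy_pnorm p f \<le> b \<longleftrightarrow> hardy_power p f \<le> ennreal (b powr max 1 p)"
proof -
  have "hardy_pnorm p f \<le> b \<longleftrightarrow> hardy_pnorm p f powr max 1 p \<le> b powr max 1 p"
    using assms(2) powr_less_mono2[of "max 1 p" b "hardy_pnorm p f"] powr_mono2[of "max 1 p" "hardy_pnorm p f" b]
    by fastforce
  then show ?thesis by (simp add: hardy_power_eq_pnorm[OF assms(1)] ennreal_le_iff)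
qed

lemma powr_add_le_add_powr:
  fixes x y p :: real
  assumes "0 \<le> x" "0 \<le> y" "0 < p" "p \<le> 1"
  shows "(x + y) powr p \<le> x powr p + y powr p"
proof (cases "x + y = 0")
  case False
  then have s: "x + y > 0" using assms by simp
  have *: "t \<le> t powr p" if "0 \<le> t" "t \<le> 1" for t :: real
    using that powr_mono'[of p 1 t] assms by (cases "t = 0") auto
  have "(x + y) powr p = (x + y) powr p * (x / (x + y) + y / (x + y))"
    using s by (simp add: add_divide_distrib[symmetric])
  also have "\<dots> \<le> (x + y) powr p * ((x / (x + y)) powr p + (y / (x + y)) powr p)"
    using s assms by (intro mult_left_mono add_mono *) auto
  also have "\<dots> = x powr p + y powr p"
    using s assms by (simp add: powr_divide distrib_left)
  finally show ?thesis .
qed (use assms in auto)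

lemma powr_convex_combination:
  fixes x y p t :: real
  assumes "0 \<le> x" "0 \<le> y" "1 \<le> p" "0 \<le> t" "t \<le> 1"
  shows "(t * x + (1 - t) * y) powr p \<le> t * x powr p + (1 - t) * y powr p"
proof -
  have *: "(t * x) powr p \<le> t * x powr p" if "0 \<le> t" "t \<le> 1" "0 \<le> x" for t x :: real
  proof -
    have "t powr p \<le> t" using that powr_mono'[of 1 p t] assms by (cases "t = 0") auto
    then show ?thesis using that by (simp add: powr_mult mult_right_mono)
  qed
  show ?thesis
  proof (cases "x = 0 \<or> y = 0")
    case True
    then show ?thesis using *[of t x] *[of "1 - t" y] assms by auto
  next
    case False
    then show ?thesis
      using convex_onD[OF powr_convex[OF assms(3)], of "1 - t" x y] assms by (simp add: algebra_simps)
  qed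
qed

text \<open>Minkowski's inequality for \<open>p > 1\<close>, from convexity of \<open>t powr p\<close> at the point
  \<open>t * (\<bar>f\<bar> / a) + (1 - t) * (\<bar>g\<bar> / b)\<close> with \<open>t = a / (a + b)\<close>; for \<open>p \<le> 1\<close> from subadditivity of
  \<open>t powr p\<close>. Strict bounds \<open>a, b > 0\<close> avoid a division by \<open>0\<close>.\<close>

lemma hardy_power_add_le:
  assumes p: "p > 0" and f: "f holomorphic_on ball 0 1" and g: "g holomorphic_on ball 0 1"
    and a: "0 < a" "hardy_power p f \<le> ennreal (a powr max 1 p)"
    and b: "0 < b" "hardy_power p g \<le> ennreal (b powr max 1 p)"
  shows "hardy_power p (\<lambda>z. f z + g z) \<le> ennreal ((a + b) powr max 1 p)"
proof -
  have fg: "(\<lambda>z. f z + g z) holomorphic_on ball 0 1" by (intro holomorphic_intros f g)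
  show ?thesis
  proof (subst hardy_power_le_iff[OF fg p], simp, safe)
    fix r :: real assume r: "0 < r" "r < 1"
    let ?F = "\<lambda>z. cmod (f (of_real r * z)) powr p" and ?G = "\<lambda>z. cmod (g (of_real r * z)) powr p"
    have cF: "continuous_on (sphere 0 1) ?F" and cG: "continuous_on (sphere 0 1) ?G"
      by (intro continuous_on_norm_powr p continuous_on_dilated_circle r holomorphic_on_imp_continuous_on f g)+
    have cFG: "continuous_on (sphere 0 1) (\<lambda>z. cmod (f (of_real r * z) + g (of_real r * z)) powr p)"
      by (intro continuous_on_norm_powr p continuous_on_add continuous_on_dilated_circle r holomorphic_on_imp_continuous_on f g)
    have F: "circle_mean ?F \<le> a powr max 1 p" using a r by (simp add: hardy_power_le_iff[OF f p])
    have G: "circle_mean ?G \<le> b powr max 1 p" using b r by (simp add: hardy_power_le_iff[OF g p])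
    show "circle_mean (\<lambda>z. cmod (f (of_real r * z) + g (of_real r * z)) powr p) \<le> (a + b) powr max 1 p"
    proof (cases "p \<le> 1")
      case True
      then have m: "max 1 p = 1" by simp
      have "circle_mean (\<lambda>z. cmod (f (of_real r * z) + g (of_real r * z)) powr p) \<le> circle_mean (\<lambda>z. ?F z + ?G z)"
      proof (rule circle_mean_mono[OF cFG continuous_on_add[OF cF cG]])
        fix z
        have "cmod (f (of_real r * z) + g (of_real r * z)) powr p
           \<le> (cmod (f (of_real r * z)) + cmod (g (of_real r * z))) powr p"
          using p by (intro powr_mono2 norm_triangle_ineq) auto
        also have "\<dots> \<le> ?F z + ?G z" using p True by (intro powr_add_le_add_powr) auto
        finally show "cmod (f (of_real r * z) + g (of_real r * z)) powr p \<le> ?F z + ?G z" .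
      qed
      also have "\<dots> = circle_mean ?F + circle_mean ?G" by (rule circle_mean_add[OF cF cG])
      also have "\<dots> \<le> a + b" using F G a(1) b(1) by (simp add: m)
      finally show ?thesis using a(1) b(1) by (simp add: m)
    next
      case False
      then have m: "max 1 p = p" by simp
      define t where "t = a / (a + b)"
      have t: "0 \<le> t" "t \<le> 1" using a b by (auto simp: t_def)
      have ab1: "(a + b) * t = a" using a b by (simp add: t_def)
      then have ab2: "(a + b) * (1 - t) = b" by (simp add: right_diff_distrib)
      define P where "P = (a + b) powr p"
      have "circle_mean (\<lambda>z. cmod (f (of_real r * z) + g (of_real r * z)) powr p)
         \<le> circle_mean (\<lambda>z. (P * t / a powr p) * ?F z + (P * (1 - t) / b powr p) * ?G z)"
      proof (rule circle_mean_mono[OF cFG])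
        show "continuous_on (sphere 0 1) (\<lambda>z. (P * t / a powr p) * ?F z + (P * (1 - t) / b powr p) * ?G z)"
          by (intro continuous_intros cF cG)
        fix z
        let ?x = "cmod (f (of_real r * z))" and ?y = "cmod (g (of_real r * z))"
        have "cmod (f (of_real r * z) + g (of_real r * z)) powr p \<le> (?x + ?y) powr p"
          using p by (intro powr_mono2 norm_triangle_ineq) auto
        also have "?x + ?y = (a + b) * (t * (?x / a) + (1 - t) * (?y / b))"
          using a b by (simp only: distrib_left mult.assoc[symmetric] ab1 ab2) simp
        also have "((a + b) * (t * (?x / a) + (1 - t) * (?y / b))) powr p
           = P * (t * (?x / a) + (1 - t) * (?y / b)) powr p"
          unfolding P_def by (rule powr_mult)
        also have "\<dots> \<le> P * (t * (?x / a) powr p + (1 - t) * (?y / b) powr p)"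
          using a b t False by (intro mult_left_mono powr_convex_combination) (auto simp: P_def)
        also have "\<dots> = (P * t / a powr p) * ?F z + (P * (1 - t) / b powr p) * ?G z"
          using a b by (simp add: powr_divide distrib_left)
        finally show "cmod (f (of_real r * z) + g (of_real r * z)) powr p
          \<le> (P * t / a powr p) * ?F z + (P * (1 - t) / b powr p) * ?G z" .
      qed
      also have "\<dots> = (P * t / a powr p) * circle_mean ?F + (P * (1 - t) / b powr p) * circle_mean ?G"
        by (subst circle_mean_add) (auto intro!: continuous_intros cF cG simp only: circle_mean_cmult)
      also have "\<dots> \<le> (P * t / a powr p) * a powr p + (P * (1 - t) / b powr p) * b powr p"
        using F G t by (intro add_mono mult_left_mono) (auto simp: P_def m)
      also have "\<dots> = P * t + P * (1 - t)" using a b by simp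
      also have "\<dots> = P" by (simp add: right_diff_distrib)
      finally show ?thesis by (simp add: P_def m)
    qed
  qed
qed

lemma hardy_space_add:
  assumes p: "p > 0" and f: "f \<in> hardy_space p" and g: "g \<in> hardy_space p"
  shows "(\<lambda>z. f z + g z) \<in> hardy_space p"
    and "hardy_pnorm p (\<lambda>z. f z + g z) \<le> hardy_pnorm p f + hardy_pnorm p g"
proof -
  have *: "hardy_power p (\<lambda>z. f z + g z) \<le> ennreal ((hardy_pnorm p f + hardy_pnorm p g + e) powr max 1 p)" if e: "e > 0" for e
  proof -
    have ge: "hardy_power p h \<le> ennreal ((hardy_pnorm p h + e / 2) powr max 1 p)" if "h \<in> hardy_space p" for h
      using hardy_pnorm_le_iff[OF that, of "hardy_pnorm p h + e / 2"] e by simp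
    have "hardy_power p (\<lambda>z. f z + g z)
       \<le> ennreal (((hardy_pnorm p f + e / 2) + (hardy_pnorm p g + e / 2)) powr max 1 p)"
      using e by (intro hardy_power_add_le[OF p hardy_spaceD(1)[OF f] hardy_spaceD(1)[OF g]] ge f g)
         (auto intro: add_nonneg_pos)
    then show ?thesis by (simp add: algebra_simps)
  qed
  show fg: "(\<lambda>z. f z + g z) \<in> hardy_space p"
    by (rule hardy_spaceI[OF _ _ *[of 1]])
       (use hardy_spaceD[OF f] hardy_spaceD[OF g] in \<open>auto intro: holomorphic_intros\<close>)
  show "hardy_pnorm p (\<lambda>z. f z + g z) \<le> hardy_pnorm p f + hardy_pnorm p g"
  proof (rule field_le_epsilon)
    fix e :: real assume e: "e > 0"
    show "hardy_pnorm p (\<lambda>z. f z + g z) \<le> hardy_pnorm p f + hardy_pnorm p g + e"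
      using *[OF e] e by (subst hardy_pnorm_le_iff[OF fg]) auto
  qed
qed

lemma hardy_power_cmult:
  assumes p: "p > 0" and f: "f \<in> hardy_space p"
  shows "(\<lambda>z. a * f z) \<in> hardy_space p"
    and "hardy_power p (\<lambda>z. a * f z) = ennreal (cmod a powr p) * hardy_power p f"
proof -
  show eq: "hardy_power p (\<lambda>z. a * f z) = ennreal (cmod a powr p) * hardy_power p f"
  proof -
    have "(\<integral>\<^sup>+ z. ennreal (cmod (a * f (of_real r * z)) powr p) \<partial>circle_measure)
       = ennreal (cmod a powr p) * (\<integral>\<^sup>+ z. ennreal (cmod (f (of_real r * z)) powr p) \<partial>circle_measure)" if "r \<in> {0<..<1}" for r
    proof -
      have c: "continuous_on (sphere 0 1) (\<lambda>z. cmod (f (of_real r * z)) powr p)"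
        by (intro continuous_on_norm_powr p continuous_on_dilated_circle holomorphic_on_imp_continuous_on hardy_spaceD(1)[OF f])
           (use that in auto)
      have "(\<integral>\<^sup>+ z. ennreal (cmod (a * f (of_real r * z)) powr p) \<partial>circle_measure)
         = (\<integral>\<^sup>+ z. ennreal (cmod a powr p * cmod (f (of_real r * z)) powr p) \<partial>circle_measure)"
        by (simp add: norm_mult powr_mult)
      also have "\<dots> = ennreal (cmod a powr p * circle_mean (\<lambda>z. cmod (f (of_real r * z)) powr p))"
        by (subst nn_integral_circle_measure) (auto intro!: continuous_intros c simp: circle_mean_cmult)
      also have "\<dots> = ennreal (cmod a powr p) * ennreal (circle_mean (\<lambda>z. cmod (f (of_real r * z)) powr p))"
        by (rule ennreal_mult) (auto intro: circle_mean_nonneg c)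
      also have "ennreal (circle_mean (\<lambda>z. cmod (f (of_real r * z)) powr p))
        = (\<integral>\<^sup>+ z. ennreal (cmod (f (of_real r * z)) powr p) \<partial>circle_measure)"
        by (rule nn_integral_circle_measure[symmetric]) (auto intro: c)
      finally show ?thesis .
    qed
    then show ?thesis unfolding hardy_power_def SUP_mult_left_ennreal by (intro SUP_cong refl)
  qed
  show "(\<lambda>z. a * f z) \<in> hardy_space p"
    unfolding hardy_space_def
    using hardy_spaceD[OF f] eq by (auto intro!: holomorphic_intros simp: ennreal_mult_less_top)
qed

lemma hardy_power_0: "p > 0 \<Longrightarrow> hardy_power p (\<lambda>z. 0) = 0"
  using hardy_power_le_iff[of "\<lambda>_. 0" p 0] by simp

lemma hardy_space_0: "p > 0 \<Longrightarrow> (\<lambda>z. 0) \<in> hardy_space p"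
  by (rule hardy_spaceI[where B = 0]) (simp_all add: hardy_power_0)

lemma hardy_power_minus_commute: "hardy_power p (\<lambda>z. f z - g z) = hardy_power p (\<lambda>z. g z - f z)"
  by (rule hardy_power_cong) (rule norm_minus_commute)

lemma hardy_space_diff:
  assumes "p > 0" "f \<in> hardy_space p" "g \<in> hardy_space p"
  shows "(\<lambda>z. f z - g z) \<in> hardy_space p"
  using hardy_space_add(1)[OF assms(1,2) hardy_power_cmult(1)[OF assms(1,3), of "-1"]] by simp

lemma hardy_growth_null:
  assumes p: "p > 0" and f: "\<And>n. f n \<in> hardy_space p" and lim: "(\<lambda>n. hardy_power p (f n)) \<longlonglongrightarrow> 0"
  shows "(\<lambda>n. f n z) \<longlonglongrightarrow> 0"
proof (cases "cmod z < 1")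
  case True
  define C where "C = (1 + cmod z) / (1 - cmod z)"
  define N where "N n = enn2real (hardy_power p (f n))" for n
  have N: "hardy_power p (f n) = ennreal (N n)" "N n \<ge> 0" for n
    using hardy_spaceD(3)[OF f] by (auto simp: N_def)
  have "N \<longlonglongrightarrow> 0" using lim by (simp add: N ennreal_tendsto_0_iff)
  then have CN: "(\<lambda>n. C * N n) \<longlonglongrightarrow> 0" by (rule tendsto_mult_right_zero)
  have le: "cmod (f n z) powr p \<le> C * N n" for n
    unfolding C_def by (rule hardy_growth[OF hardy_spaceD(1)[OF f] p _ _ True]) (use N in auto)
  have "(\<lambda>n. cmod (f n z) powr p) \<longlonglongrightarrow> 0"
    by (rule tendsto_sandwich[OF _ _ tendsto_const[of 0] CN]) (simp_all add: le)
  then have "(\<lambda>n. (cmod (f n z) powr p) powr (1 / p)) \<longlonglongrightarrow> 0 powr (1 / p)"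
    by (rule tendsto_powr') (use p in auto)
  then have "(\<lambda>n. cmod (f n z)) \<longlonglongrightarrow> 0" using p by (simp add: powr_powr)
  then show ?thesis by (rule tendsto_norm_zero_cancel)
next
  case False
  then show ?thesis using hardy_spaceD(2)[OF f] by simp
qed

lemma hardy_power_eq_0:
  assumes p: "p > 0" and f: "f \<in> hardy_space p" and 0: "hardy_power p f = 0"
  shows "f = (\<lambda>z. 0)"
proof
  fix z
  have "(\<lambda>n::nat. f z) \<longlonglongrightarrow> 0" by (rule hardy_growth_null[OF p]) (use f 0 in auto)
  then show "f z = 0" by (simp add: LIMSEQ_const_iff)
qed

definition hardy_dist :: "real \<Rightarrow> (complex \<Rightarrow> complex) \<Rightarrow> (complex \<Rightarrow> complex) \<Rightarrow> real" where
  "hardy_dist p f g = hardy_pnorm p (\<lambda>z. g z - f z)"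

lemma Metric_space_hardy:
  assumes p: "p > 0"
  shows "Metric_space (hardy_space p) (hardy_dist p)"
proof
  fix f g show "0 \<le> hardy_dist p f g" by (simp add: hardy_dist_def)
  show "hardy_dist p f g = hardy_dist p g f"
    by (simp add: hardy_dist_def hardy_pnorm_def hardy_power_minus_commute[of p f g])
next
  fix f g assume f: "f \<in> hardy_space p" and g: "g \<in> hardy_space p"
  note d = hardy_space_diff[OF p g f]
  show "hardy_dist p f g = 0 \<longleftrightarrow> f = g"
  proof
    assume "hardy_dist p f g = 0"
    then have "hardy_power p (\<lambda>z. g z - f z) = 0" using hardy_power_eq_pnorm[OF d] by (simp add: hardy_dist_def)
    from fun_cong[OF hardy_power_eq_0[OF p d this]] show "f = g" by (auto simp: fun_eq_iff)
  next
    assume "f = g"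
    then have "hardy_pnorm p (\<lambda>z. g z - f z) \<le> 0"
      using d p by (subst hardy_pnorm_le_iff) (simp_all add: hardy_power_0)
    then show "hardy_dist p f g = 0" unfolding hardy_dist_def by (intro antisym) auto
  qed
  fix h assume h: "h \<in> hardy_space p"
  show "hardy_dist p f h \<le> hardy_dist p f g + hardy_dist p g h"
    using hardy_space_add(2)[OF p hardy_space_diff[OF p g f] hardy_space_diff[OF p h g]]
    by (simp add: hardy_dist_def)
qed

text \<open>The distance is a power of the quasi-norm with a positive exponent, so both have the same
  balls up to a change of radius.\<close>

lemma quasinorm_topology_hardy:
  assumes p: "p > 0"
  shows "quasinorm_topology (hardy_space p) (hardy_norm p) = Metric_space.mtopology (hardy_space p) (hardy_dist p)"
proof -
  interpret Metric_space "hardy_space p" "hardy_dist p" by (rule Metric_space_hardy[OF p])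
  define m where "m = max 1 p"
  have m: "m > 0" by (simp add: m_def)
  have norm1: "hardy_norm p f = hardy_pnorm p f powr (m / p)" for f
    using m by (simp add: hardy_norm_def hardy_pnorm_def powr_powr flip: m_def)
  have norm2: "hardy_pnorm p f = hardy_norm p f powr (p / m)" for f
    using p m by (simp add: norm1 powr_powr)
  have *: "(\<exists>e>0. \<forall>g\<in>hardy_space p. hardy_norm p (\<lambda>x. g x - f x) < e \<longrightarrow> g \<in> U)
       \<longleftrightarrow> (\<exists>r>0. mball f r \<subseteq> U)" if f: "f \<in> hardy_space p" for f U
  proof
    assume "\<exists>e>0. \<forall>g\<in>hardy_space p. hardy_norm p (\<lambda>x. g x - f x) < e \<longrightarrow> g \<in> U"
    then obtain e where e: "e > 0" "\<And>g. g \<in> hardy_space p \<Longrightarrow> hardy_norm p (\<lambda>x. g x - f x) < e \<Longrightarrow> g \<in> U" by blast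
    have "mball f (e powr (p / m)) \<subseteq> U"
    proof
      fix g assume g: "g \<in> mball f (e powr (p / m))"
      then have "hardy_pnorm p (\<lambda>x. g x - f x) < e powr (p / m)" by (simp add: hardy_dist_def)
      then have "hardy_pnorm p (\<lambda>x. g x - f x) powr (m / p) < (e powr (p / m)) powr (m / p)"
        using p m by (intro powr_less_mono2) auto
      then show "g \<in> U" using e g p m by (simp add: norm1 powr_powr)
    qed
    then show "\<exists>r>0. mball f r \<subseteq> U" using e by (intro exI[of _ "e powr (p / m)"]) auto
  next
    assume "\<exists>r>0. mball f r \<subseteq> U"
    then obtain r where r: "r > 0" "mball f r \<subseteq> U" by blast
    have "g \<in> U" if g: "g \<in> hardy_space p" "hardy_norm p (\<lambda>x. g x - f x) < r powr (m / p)" for g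
    proof -
      have "hardy_norm p (\<lambda>x. g x - f x) powr (p / m) < (r powr (m / p)) powr (p / m)"
        using p m g by (intro powr_less_mono2) (auto simp: hardy_norm_def)
      then have "hardy_pnorm p (\<lambda>x. g x - f x) < r" using r p m by (simp add: norm2 powr_powr)
      then show ?thesis using f g r by (auto simp: hardy_dist_def)
    qed
    then show "\<exists>e>0. \<forall>g\<in>hardy_space p. hardy_norm p (\<lambda>x. g x - f x) < e \<longrightarrow> g \<in> U"
      using r by (intro exI[of _ "r powr (m / p)"]) auto
  qed
  show ?thesis
    unfolding topology_eq openin_quasinorm_topology openin_mtopology using * by blast
qed

lemma hardy_dist_tendsto_0_iff:
  assumes p: "p > 0" and f: "\<And>n. f n \<in> hardy_space p" and g: "g \<in> hardy_space p"
  shows "(\<lambda>n. hardy_dist p (f n) g) \<longlonglongrightarrow> 0 \<longleftrightarrow> (\<lambda>n. hardy_power p (\<lambda>z. f n z - g z)) \<longlonglongrightarrow> 0"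
proof -
  define N where "N n = enn2real (hardy_power p (\<lambda>z. f n z - g z))" for n
  have N: "hardy_power p (\<lambda>z. f n z - g z) = ennreal (N n)" "N n \<ge> 0" for n
    using hardy_spaceD(3)[OF hardy_space_diff[OF p f g]] by (auto simp: N_def)
  have d: "hardy_dist p (f n) g = N n powr (1 / max 1 p)" for n
    by (simp add: hardy_dist_def hardy_pnorm_def N_def hardy_power_minus_commute[of p g])
  have "(\<lambda>n. N n powr (1 / max 1 p)) \<longlonglongrightarrow> 0 \<longleftrightarrow> N \<longlonglongrightarrow> 0"
  proof
    assume "(\<lambda>n. N n powr (1 / max 1 p)) \<longlonglongrightarrow> 0"
    then have "(\<lambda>n. (N n powr (1 / max 1 p)) powr max 1 p) \<longlonglongrightarrow> 0 powr max 1 p"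
      by (rule tendsto_powr') auto
    moreover have "max 1 p \<noteq> 0" by linarith
    ultimately show "N \<longlonglongrightarrow> 0" using N by (simp add: powr_powr)
  next
    assume "N \<longlonglongrightarrow> 0"
    then have "(\<lambda>n. N n powr (1 / max 1 p)) \<longlonglongrightarrow> 0 powr (1 / max 1 p)"
      by (rule tendsto_powr') (auto simp: N)
    then show "(\<lambda>n. N n powr (1 / max 1 p)) \<longlonglongrightarrow> 0" by simp
  qed
  then show ?thesis by (simp add: d N ennreal_tendsto_0_iff)
qed

section \<open>Linear combinations of composition operators\<close>

lemma tendsto_0_ennrealI:
  fixes f :: "nat \<Rightarrow> ennreal"
  assumes "\<And>e::real. e > 0 \<Longrightarrow> \<forall>\<^sub>F n in sequentially. f n \<le> ennreal e"
  shows "f \<longlonglongrightarrow> 0"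
proof (rule order_tendstoI)
  fix a :: ennreal assume "0 < a"
  then obtain x where x: "0 < x" "x < a" using dense by blast
  then obtain e where e: "x = ennreal e" "e \<ge> 0" by (cases x) auto
  then have "e > 0" using x by (cases "e = 0") auto
  from assms[OF this] show "\<forall>\<^sub>F n in sequentially. f n < a"
    by (rule eventually_mono) (use x e in auto)
qed auto

lemma hardy_norm_le_1_iff:
  assumes p: "p > 0" and f: "f \<in> hardy_space p"
  shows "hardy_norm p f \<le> 1 \<longleftrightarrow> hardy_power p f \<le> 1"
proof -
  define B where "B = enn2real (hardy_power p f)"
  have B: "hardy_power p f = ennreal B" "B \<ge> 0"
    using hardy_spaceD(3)[OF f] by (auto simp: B_def)
  have "B powr (1 / p) \<le> 1 \<longleftrightarrow> B \<le> 1"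
  proof (cases "B \<le> 1")
    case True
    then show ?thesis using powr_mono2[of "1 / p" B 1] p B(2) by simp
  next
    case False
    then have "1 powr (1 / p) < B powr (1 / p)" using p by (intro powr_less_mono2) auto
    then show ?thesis using False by simp
  qed
  then show ?thesis using B by (simp add: hardy_norm_def ennreal_le_1)
qed

locale composition_combination =
  fixes N :: nat and \<phi> :: "nat \<Rightarrow> complex \<Rightarrow> complex" and c :: "nat \<Rightarrow> complex"
    and T :: "(complex \<Rightarrow> complex) \<Rightarrow> complex \<Rightarrow> complex"
  assumes N: "N \<ge> 1"
    and phi: "\<And>j. j \<in> {1..N} \<Longrightarrow> holomorphic_self_map (\<phi> j)"
    and T_eq: "T = (\<lambda>f z. \<Sum>j=1..N. c j * comp_op (\<phi> j) f z)"
begin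

lemma T_apply: "cmod z < 1 \<Longrightarrow> T f z = (\<Sum>j=1..N. c j * f (\<phi> j z))"
  by (simp add: T_eq comp_op_def)

lemma T_outside: "\<not> cmod z < 1 \<Longrightarrow> T f z = 0"
  by (simp add: T_eq comp_op_def)

lemma T_diff: "T (\<lambda>z. f z - g z) = (\<lambda>z. T f z - T g z)"
proof (rule ext)
  show "T (\<lambda>z. f z - g z) z = T f z - T g z" for z
    by (cases "cmod z < 1") (simp_all add: T_apply T_outside right_diff_distrib sum_subtractf)
qed

lemma T_cmult: "T (\<lambda>z. a * f z) = (\<lambda>z. a * T f z)"
proof (rule ext)
  show "T (\<lambda>z. a * f z) z = a * T f z" for z
    by (cases "cmod z < 1") (simp_all add: T_apply T_outside sum_distrib_left mult.left_commute)
qed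

lemma phi_disk: "j \<in> {1..N} \<Longrightarrow> cmod z < 1 \<Longrightarrow> cmod (\<phi> j z) < 1"
  by (rule holomorphic_self_mapD(2)[OF phi])

lemma T_holomorphic:
  assumes "f holomorphic_on ball 0 1"
  shows "T f holomorphic_on ball 0 1"
  unfolding T_eq by (intro holomorphic_intros comp_op_holomorphic assms phi)

lemma T_tendsto:
  assumes "\<And>z. cmod z < 1 \<Longrightarrow> (\<lambda>n. f n z) \<longlonglongrightarrow> g z" "cmod z < 1"
  shows "(\<lambda>n. T (f n) z) \<longlonglongrightarrow> T g z"
  unfolding T_apply[OF assms(2)]
  by (intro tendsto_sum tendsto_mult_left assms(1) phi_disk assms(2))

lemma T_hardy_space:
  assumes p: "p > 0" and f: "f \<in> hardy_space p"
  shows "T f \<in> hardy_space p"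
proof -
  define B where "B = enn2real (hardy_power p f)"
  have B: "hardy_power p f \<le> ennreal B" "B \<ge> 0"
    using hardy_spaceD(3)[OF f] by (auto simp: B_def)
  have "comp_op (\<phi> j) f \<in> hardy_space p" if "j \<in> {1..N}" for j
    by (rule hardy_spaceI[OF comp_op_holomorphic[OF hardy_spaceD(1)[OF f] phi[OF that]]
           _ Littlewood_subordination[OF hardy_spaceD(1)[OF f] phi[OF that] p B]])
       (simp add: comp_op_def)
  note C = this
  have "(\<lambda>z. \<Sum>j\<in>J. c j * comp_op (\<phi> j) f z) \<in> hardy_space p" if "finite J" "J \<subseteq> {1..N}" for J
    using that
  proof (induction J rule: finite_induct)
    case empty
    then show ?case using hardy_space_0[OF p] by simp
  next
    case (insert j J)
    have "j \<in> {1..N}" "J \<subseteq> {1..N}" using insert.prems by auto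
    from hardy_space_add(1)[OF p hardy_power_cmult(1)[OF p C[OF this(1)], of "c j"] insert.IH[OF this(2)]]
    show ?case using insert.hyps by simp
  qed
  from this[of "{1..N}"] show ?thesis by (simp add: T_eq)
qed

text \<open>A subsequence on which the norms stay above \<open>e\<close> would have a further subsequence that converges
  in \<open>H\<^sup>p\<close>. Norm convergence implies pointwise convergence, and the images tend to \<open>0\<close> pointwise,
  so the limit is \<open>0\<close>.\<close>

lemma compact_imp_null:
  assumes p: "p > 0" and comp: "compact_on_hardy p T"
    and f: "\<And>n. f n \<in> hardy_space p" and B: "\<And>n. hardy_power p (f n) \<le> ennreal B"
    and lim: "\<And>z. cmod z < 1 \<Longrightarrow> (\<lambda>n. f n z) \<longlonglongrightarrow> 0"
  shows "(\<lambda>n. hardy_power p (T (f n))) \<longlonglongrightarrow> 0"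
proof -
  interpret Metric_space "hardy_space p" "hardy_dist p" by (rule Metric_space_hardy[OF p])
  define b where "b = max 1 B"
  have b: "b > 0" "B \<le> b" by (auto simp: b_def)
  define s where "s = b powr (- 1 / p)"
  have s: "cmod (of_real s) = b powr (- 1 / p)" unfolding s_def norm_of_real by simp
  have sp: "cmod (of_real s) powr p = 1 / b"
    unfolding s powr_powr using b p by (simp add: powr_minus_divide)
  define h where "h n = (\<lambda>z. of_real s * f n z)" for n
  have h: "h n \<in> hardy_space p" for n unfolding h_def by (rule hardy_power_cmult(1)[OF p f])
  have "hardy_power p (h n) \<le> 1" for n
  proof -
    have "hardy_power p (h n) = ennreal (1 / b) * hardy_power p (f n)"
      unfolding h_def by (simp only: hardy_power_cmult(2)[OF p f] sp)
    also have "\<dots> \<le> ennreal (1 / b) * ennreal b"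
      using B[of n] b by (intro mult_left_mono order_trans[OF B] ennreal_leI) auto
    also have "\<dots> = 1" using b by (simp flip: ennreal_mult)
    finally show ?thesis .
  qed
  then have hn: "hardy_norm p (h n) \<le> 1" for n using hardy_norm_le_1_iff[OF p h] by simp
  define a where "a n = enn2real (hardy_power p (T (h n)))" for n
  have a: "hardy_power p (T (h n)) = ennreal (a n)" "a n \<ge> 0" for n
    using hardy_spaceD(3)[OF T_hardy_space[OF p h]] by (auto simp: a_def)
  define S where "S = T ` {f \<in> hardy_space p. hardy_norm p f \<le> 1}"
  have K: "S \<subseteq> hardy_space p" "compactin mtopology (mtopology closure_of S)"
    using comp unfolding compact_on_hardy_def relatively_compactin_def quasinorm_topology_hardy[OF p] S_def[symmetric]
    by auto
  have "a \<longlonglongrightarrow> 0"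
  proof (rule ccontr)
    assume "\<not> a \<longlonglongrightarrow> 0"
    then obtain e where e: "e > 0" "\<not> (\<forall>\<^sub>F n in sequentially. a n < e)"
      using a(2) by (auto simp: tendsto_iff)
    then have "infinite {n. e \<le> a n}"
      by (simp add: not_eventually not_less flip: frequently_cofinite cofinite_eq_sequentially)
    from infinite_enumerate[OF this] obtain r0 :: "nat \<Rightarrow> nat"
      where r0: "strict_mono r0" "\<And>n. e \<le> a (r0 n)" by blast
    have "range (\<lambda>n. T (h (r0 n))) \<subseteq> mtopology closure_of S"
      using closure_of_subset[of S mtopology] K(1) h hn by (auto simp: S_def)
    then obtain l r where l: "strict_mono r" "limitin mtopology ((\<lambda>n. T (h (r0 n))) \<circ> r) l sequentially"
      using K(2) unfolding compactin_sequentially by blast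
    define \<tau> where "\<tau> n = h (r0 (r n))" for n
    have V: "l \<in> hardy_space p" using l(2) by (simp add: limitin_metric_dist_null)
    have "(\<lambda>n. hardy_dist p (T (\<tau> n)) l) \<longlonglongrightarrow> 0"
      using l(2) by (simp add: limitin_metric_dist_null \<tau>_def o_def)
    then have conv: "(\<lambda>n. hardy_power p (\<lambda>z. T (\<tau> n) z - l z)) \<longlonglongrightarrow> 0"
      by (subst (asm) hardy_dist_tendsto_0_iff[OF p _ V]) (auto simp: \<tau>_def T_hardy_space p h)
    have sub: "strict_mono (\<lambda>n. r0 (r n))" using r0(1) l(1) by (simp add: strict_mono_def)
    have T0: "T (\<lambda>z. 0) z = 0" for z by (simp add: T_eq comp_op_def)
    have "l z = 0" for z
    proof (cases "cmod z < 1")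
      case True
      have "(\<lambda>n. \<tau> n z) \<longlonglongrightarrow> 0" if "cmod z < 1" for z
        using LIMSEQ_subseq_LIMSEQ[OF tendsto_mult_right_zero[OF lim[OF that], of "of_real s"] sub]
        by (simp add: \<tau>_def h_def o_def)
      then have 1: "(\<lambda>n. T (\<tau> n) z) \<longlonglongrightarrow> T (\<lambda>z. 0) z" by (rule T_tendsto[OF _ True])
      have "(\<lambda>n. T (\<tau> n) z - l z) \<longlonglongrightarrow> 0"
        by (rule hardy_growth_null[OF p hardy_space_diff[OF p T_hardy_space[OF p] V] conv]) (simp add: \<tau>_def h)
      from tendsto_diff[OF 1 this] have "(\<lambda>n::nat. l z) \<longlonglongrightarrow> 0" by (simp add: T0)
      then show ?thesis by (simp add: LIMSEQ_const_iff)
    qed (use hardy_spaceD(2)[OF V] in auto)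
    then have "(\<lambda>n. hardy_power p (T (\<tau> n))) \<longlonglongrightarrow> 0" using conv by simp
    then have "(\<lambda>n. a (r0 (r n))) \<longlonglongrightarrow> 0" by (simp add: \<tau>_def a ennreal_tendsto_0_iff)
    then have "e \<le> 0" by (rule tendsto_lowerbound) (use r0(2) in auto)
    then show False using e by simp
  qed
  moreover have "hardy_power p (T (f n)) = ennreal (b * a n)" for n
  proof -
    have "f n = (\<lambda>z. of_real (1 / s) * h n z)" using b by (simp add: h_def s_def)
    then have "hardy_power p (T (f n)) = hardy_power p (\<lambda>z. of_real (1 / s) * T (h n) z)"
      using T_cmult by metis
    also have "\<dots> = ennreal (cmod (of_real (1 / s)) powr p) * ennreal (a n)"
      by (simp only: hardy_power_cmult(2)[OF p T_hardy_space[OF p h]] a)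
    also have "cmod (of_real (1 / s)) powr p = 1 / cmod (of_real s) powr p"
      by (simp add: norm_divide powr_divide)
    also have "\<dots> = b" unfolding sp by simp
    also have "ennreal b * ennreal (a n) = ennreal (b * a n)"
      by (rule ennreal_mult[symmetric]) (use a b in auto)
    finally show ?thesis .
  qed
  ultimately show ?thesis using a(2) b by (simp add: ennreal_tendsto_0_iff tendsto_mult_right_zero)
qed

text \<open>The image of the closed unit ball is itself compact: by the growth estimate the ball is a normal
  family, by Fatou's lemma it contains its locally uniform limits, and the hypothesis applies
  to the differences \<open>f (r n) - g\<close>.\<close>

lemma null_imp_compact:
  assumes p: "p > 0"
    and null: "\<And>f B. (\<And>n. f n \<in> hardy_space p) \<Longrightarrow> (\<And>n. hardy_power p (f n) \<le> ennreal B) \<Longrightarrow>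
        (\<And>R. 0 < R \<Longrightarrow> R < 1 \<Longrightarrow> uniform_limit (cball 0 R) f (\<lambda>z. 0) sequentially) \<Longrightarrow>
        (\<lambda>n. hardy_power p (T (f n))) \<longlonglongrightarrow> 0"
  shows "compact_on_hardy p T"
proof -
  interpret Metric_space "hardy_space p" "hardy_dist p" by (rule Metric_space_hardy[OF p])
  define S where "S = T ` {f \<in> hardy_space p. hardy_norm p f \<le> 1}"
  have SV: "S \<subseteq> hardy_space p" unfolding S_def using T_hardy_space[OF p] by auto
  have "compactin mtopology S"
    unfolding compactin_sequentially
  proof (intro conjI SV allI impI)
    fix \<sigma> :: "nat \<Rightarrow> complex \<Rightarrow> complex" assume "range \<sigma> \<subseteq> S"
    then have "\<forall>n. \<exists>f. f \<in> hardy_space p \<and> hardy_norm p f \<le> 1 \<and> \<sigma> n = T f"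
      by (fastforce simp: S_def)
    then obtain f where f: "\<And>n. f n \<in> hardy_space p" "\<And>n. hardy_norm p (f n) \<le> 1" "\<And>n. \<sigma> n = T (f n)"
      by metis
    have f1: "hardy_power p (f n) \<le> 1" for n using hardy_norm_le_1_iff[OF p f(1)] f(2) by simp
    have local_bound: "\<exists>B. \<forall>h\<in>range f. \<forall>z\<in>K. cmod (h z) \<le> B" if K: "compact K" "K \<subseteq> ball 0 1" for K
    proof -
      define u where "u z = ((1 + cmod z) / (1 - cmod z)) powr (1 / p)" for z
      have "continuous_on K u"
        unfolding u_def using K p
        by (intro continuous_on_powr' continuous_intros) (auto simp: subset_iff intro!: divide_pos_pos add_pos_nonneg)
      then have "bounded (u ` K)" by (intro compact_imp_bounded compact_continuous_image K)
      then obtain B where "\<forall>x\<in>u ` K. norm x \<le> B" unfolding bounded_iff by blast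
      then have B: "u z \<le> B" if "z \<in> K" for z using that by (auto simp: abs_le_iff)
      have "cmod (f n z) \<le> B" if z: "z \<in> K" for n z
      proof -
        have z1: "cmod z < 1" using z K by auto
        have "cmod (f n z) powr p \<le> (1 + cmod z) / (1 - cmod z)"
          using hardy_growth[OF hardy_spaceD(1)[OF f(1)] p _ _ z1, of n 1] f1 by simp
        then have "(cmod (f n z) powr p) powr (1 / p) \<le> u z"
          unfolding u_def using p by (intro powr_mono2) auto
        then show ?thesis using p B[OF z] by (simp add: powr_powr)
      qed
      then show ?thesis by auto
    qed
    have hol: "\<And>h. h \<in> range f \<Longrightarrow> h holomorphic_on ball 0 1" using hardy_spaceD(1)[OF f(1)] by auto
    have "\<exists>g r. g holomorphic_on ball 0 1 \<and> strict_mono r \<and> (\<forall>z\<in>ball 0 1. (\<lambda>n. f (r n) z) \<longlonglongrightarrow> g z) \<and>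
       (\<forall>K. compact K \<and> K \<subseteq> ball 0 1 \<longrightarrow> uniform_limit K (f \<circ> r) g sequentially)"
    proof (rule Montel[OF open_ball hol local_bound order_refl])
      fix g r assume "g holomorphic_on ball 0 1" "strict_mono (r :: nat \<Rightarrow> nat)"
        "\<And>z. z \<in> ball 0 1 \<Longrightarrow> (\<lambda>n. f (r n) z) \<longlonglongrightarrow> g z"
        "\<And>K. compact K \<Longrightarrow> K \<subseteq> ball 0 1 \<Longrightarrow> uniform_limit K (f \<circ> r) g sequentially"
      then show "\<exists>g r. g holomorphic_on ball 0 1 \<and> strict_mono r \<and> (\<forall>z\<in>ball 0 1. (\<lambda>n. f (r n) z) \<longlonglongrightarrow> g z) \<and>
         (\<forall>K. compact K \<and> K \<subseteq> ball 0 1 \<longrightarrow> uniform_limit K (f \<circ> r) g sequentially)"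
        by (intro exI[of _ g] exI[of _ r]) auto
    qed
    then obtain g0 r where g0: "g0 holomorphic_on ball 0 1" "strict_mono r"
      "\<And>z. cmod z < 1 \<Longrightarrow> (\<lambda>n. f (r n) z) \<longlonglongrightarrow> g0 z"
      "\<And>K. compact K \<Longrightarrow> K \<subseteq> ball 0 1 \<Longrightarrow> uniform_limit K (f \<circ> r) g0 sequentially" by auto
    define g where "g z = (if cmod z < 1 then g0 z else 0)" for z
    have gh: "g holomorphic_on ball 0 1"
      by (rule holomorphic_transform[OF g0(1)]) (simp add: g_def)
    have g1: "hardy_power p g \<le> 1"
      by (rule hardy_power_Fatou[where f = "\<lambda>n. f (r n)"])
         (use hardy_spaceD(1)[OF f(1)] gh g0(3) f1 p in \<open>auto simp: g_def\<close>)
    have g: "g \<in> hardy_space p"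
      by (rule hardy_spaceI[OF gh, of _ 1]) (use g1 in \<open>auto simp: g_def\<close>)
    have gn: "hardy_norm p g \<le> 1" using hardy_norm_le_1_iff[OF p g] g1 by simp
    have d: "(\<lambda>z. f (r n) z - g z) \<in> hardy_space p" for n by (rule hardy_space_diff[OF p f(1) g])
    have "(\<lambda>n. hardy_power p (T (\<lambda>z. f (r n) z - g z))) \<longlonglongrightarrow> 0"
    proof (rule null[OF d])
      fix n
      have "hardy_power p (\<lambda>z. f (r n) z + (- 1) * g z) \<le> ennreal ((1 + 1) powr max 1 p)"
        using hardy_power_cmult(2)[OF p g, of "-1"] f1 g1
        by (intro hardy_power_add_le p hardy_spaceD(1)[OF f(1)] hardy_spaceD(1)[OF hardy_power_cmult(1)[OF p g]]) auto
      then show "hardy_power p (\<lambda>z. f (r n) z - g z) \<le> ennreal (2 powr max 1 p)" by simp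
    next
      fix R :: real assume R: "0 < R" "R < 1"
      then have "uniform_limit (cball 0 R) (f \<circ> r) g0 sequentially" by (intro g0(4)) auto
      then show "uniform_limit (cball 0 R) (\<lambda>n z. f (r n) z - g z) (\<lambda>z. 0) sequentially"
        using R by (auto simp: uniform_limit_iff g_def dist_norm elim!: eventually_mono all_forward)
    qed
    then have "(\<lambda>n. hardy_dist p (T (f (r n))) (T g)) \<longlonglongrightarrow> 0"
      by (subst hardy_dist_tendsto_0_iff) (auto simp: T_diff p T_hardy_space f g)
    then have "limitin mtopology (\<sigma> \<circ> r) (T g) sequentially"
      by (simp add: limitin_metric_dist_null T_hardy_space p f g o_def)
    moreover have "T g \<in> S" unfolding S_def using g gn by blast
    ultimately show "\<exists>l r. l \<in> S \<and> strict_mono r \<and> limitin mtopology (\<sigma> \<circ> r) l sequentially"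
      using g0(2) by blast
  qed
  moreover from this have "mtopology closure_of S = S"
    by (intro closure_of_closedin compactin_imp_closedin Hausdorff_space_mtopology)
  ultimately show ?thesis
    unfolding compact_on_hardy_def relatively_compactin_def quasinorm_topology_hardy[OF p] S_def[symmetric]
    using SV by simp
qed

end

section \<open>Transfer between exponents\<close>

text \<open>In the right half plane \<open>\<bar>Im (Ln w)\<bar> \<le> \<pi> / 2\<close>, so a bounded imaginary part of the exponent
  changes the modulus of the power only by a bounded factor.\<close>

lemma Ln_power_bound:
  assumes w: "1 \<le> Re w" and s: "\<bar>Im s\<bar> \<le> 2"
  shows "cmod (exp (s * Ln w)) \<le> cmod w powr Re s * exp pi"
proof -
  have nz: "w \<noteq> 0" using w by auto
  have im: "\<bar>Im (Ln w)\<bar> \<le> pi / 2"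
    using Re_Ln_pos_lt[OF nz] w by simp
  have "- Im s * Im (Ln w) \<le> \<bar>Im s\<bar> * \<bar>Im (Ln w)\<bar>"
    by (metis abs_ge_self abs_minus_cancel abs_mult mult_minus_left)
  also have "\<dots> \<le> 2 * (pi / 2)" by (intro mult_mono s im) auto
  finally have *: "- Im s * Im (Ln w) \<le> pi" by simp
  have "cmod (exp (s * Ln w)) = exp (Re s * ln (cmod w)) * exp (- Im s * Im (Ln w))"
    using nz by (simp add: Re_Ln flip: exp_add)
  also have "\<dots> \<le> exp (Re s * ln (cmod w)) * exp pi"
    using * by (intro mult_left_mono) auto
  also have "exp (Re s * ln (cmod w)) = cmod w powr Re s"
    using nz by (simp add: powr_def)
  finally show ?thesis .
qed

lemma holomorphic_self_map_id: "holomorphic_self_map (\<lambda>z. z)"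
  by (auto simp: holomorphic_self_map_def)

context composition_combination
begin

text \<open>The interpolation step. It concerns functions continuous on the closed disk, for which \<open>W\<close> is
  available; the general case follows by dilation.\<close>

lemma null_transfer:
  fixes g :: "nat \<Rightarrow> complex \<Rightarrow> complex"
  assumes p: "p > 0" and q: "q > 0"
    and null: "\<And>f B. (\<And>n. f n \<in> hardy_space p) \<Longrightarrow> (\<And>n. hardy_power p (f n) \<le> ennreal B) \<Longrightarrow>
        (\<And>z. cmod z < 1 \<Longrightarrow> (\<lambda>n. f n z) \<longlonglongrightarrow> 0) \<Longrightarrow> (\<lambda>n. hardy_power p (T (f n))) \<longlonglongrightarrow> 0"
    and g: "\<And>n. continuous_on (cball 0 1) (g n)" "\<And>n. g n holomorphic_on ball 0 1"
    and B: "\<And>n. circle_mean (\<lambda>z. cmod (g n z) powr q) \<le> B"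
    and lim: "\<And>z. cmod z < 1 \<Longrightarrow> (\<lambda>n. g n z) \<longlonglongrightarrow> 0"
  shows "(\<lambda>n. hardy_power q (T (g n))) \<longlonglongrightarrow> 0"
proof -
  define D where "D = 4 * B + 16"
  have "\<exists>W. W holomorphic_on UNIV \<and> (\<forall>z. cmod z \<le> 1 \<longrightarrow> 1 \<le> Re (W z)) \<and>
      (\<forall>z. cmod z \<le> 1 \<longrightarrow> cmod (g n z) \<le> cmod (W z) powr (2 / q)) \<and>
      circle_mean (\<lambda>z. (cmod (W z))\<^sup>2) \<le> D" for n
  proof (rule half_plane_majorant[OF g q])
    fix W assume "W holomorphic_on UNIV" "\<And>z. cmod z \<le> 1 \<Longrightarrow> 1 \<le> Re (W z)"
      "\<And>z. cmod z \<le> 1 \<Longrightarrow> cmod (g n z) \<le> cmod (W z) powr (2 / q)"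
      "circle_mean (\<lambda>z. (cmod (W z))\<^sup>2) \<le> 4 * circle_mean (\<lambda>z. cmod (g n z) powr q) + 16"
    then show ?thesis using B[of n] by (intro exI[of _ W]) (auto simp: D_def)
  qed
  then have "\<exists>W. \<forall>n. W n holomorphic_on UNIV \<and> (\<forall>z. cmod z \<le> 1 \<longrightarrow> 1 \<le> Re (W n z)) \<and>
      (\<forall>z. cmod z \<le> 1 \<longrightarrow> cmod (g n z) \<le> cmod (W n z) powr (2 / q)) \<and>
      circle_mean (\<lambda>z. (cmod (W n z))\<^sup>2) \<le> D"
    by (intro choice allI)
  then obtain W where W: "\<And>n. W n holomorphic_on UNIV" "\<And>n z. cmod z \<le> 1 \<Longrightarrow> 1 \<le> Re (W n z)"
      "\<And>n z. cmod z \<le> 1 \<Longrightarrow> cmod (g n z) \<le> cmod (W n z) powr (2 / q)"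
      "\<And>n. circle_mean (\<lambda>z. (cmod (W n z))\<^sup>2) \<le> D"
    by blast
  have W1: "1 \<le> cmod (W n z)" if "cmod z \<le> 1" for n z
    using W(2)[OF that, of n] complex_Re_le_cmod[of "W n z"] by linarith
  have cW: "continuous_on S (W n)" for S n by (rule entire_continuous_on[OF W(1)])
  have hW: "W n holomorphic_on S" for S n by (rule holomorphic_on_subset[OF W(1)]) auto
  have D0: "D \<ge> 0"
    by (rule order_trans[OF circle_mean_nonneg W(4)[of 0]]) (auto intro!: continuous_intros cW)
  have WD: "circle_mean (\<lambda>z. (cmod (W n (\<psi> (of_real r * z))))\<^sup>2) \<le> subordination_const \<psi> * D"
    if "holomorphic_self_map \<psi>" "0 < r" "r < 1" for n \<psi> r
  proof -
    have "circle_mean (\<lambda>z. cmod (W n (\<psi> (of_real r * z))) powr 2)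
        \<le> subordination_const \<psi> * circle_mean (\<lambda>z. cmod (W n z) powr 2)"
      by (rule Littlewood_subordination_closed_disk[OF cW hW that(1) _ that(2,3)]) simp
    also have "\<dots> \<le> subordination_const \<psi> * D"
      using W(4)[of n] subordination_const_ge_1[OF that(1)] by (intro mult_left_mono) auto
    finally show ?thesis by simp
  qed

  define x0 where "x0 = complex_of_real (2 / q)"
  define x1 where "x1 = complex_of_real (2 / p)"
  define s where "s k = x1 + \<i> * of_real (1 / real (k + 1))" for k
  define \<Omega> where "\<Omega> = {z. 0 < Re z} \<inter> ({z. - 2 < Im z} \<inter> {z. Im z < 2})"
  have \<Omega>: "open \<Omega>" "connected \<Omega>"
    unfolding \<Omega>_def
    by (intro open_Int open_halfspace_Re_gt open_halfspace_Im_gt open_halfspace_Im_lt)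
       (intro convex_connected convex_Int convex_halfspace_Re_gt convex_halfspace_Im_gt convex_halfspace_Im_lt)
  have x\<Omega>: "x0 \<in> \<Omega>" "x1 \<in> \<Omega>" using p q by (auto simp: \<Omega>_def x0_def x1_def)
  have s1: "Re (s k) = 2 / p" "0 < Im (s k)" "Im (s k) \<le> 1" for k
    by (auto simp: s_def x1_def)
  have s\<Omega>: "s k \<in> \<Omega>" "s k \<noteq> x1" for k
    using s1[of k] p by (auto simp: \<Omega>_def x1_def)
  have slim: "s \<longlonglongrightarrow> x1"
  proof -
    have "(\<lambda>k. 1 / real (k + 1)) \<longlonglongrightarrow> 0"
      using LIMSEQ_ignore_initial_segment[OF lim_1_over_n, of 1] by simp
    then have "(\<lambda>k. x1 + \<i> * of_real (1 / real (k + 1))) \<longlonglongrightarrow> x1 + \<i> * of_real 0"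
      by (intro tendsto_add tendsto_mult tendsto_const tendsto_of_real)
    then show ?thesis by (simp add: s_def[abs_def])
  qed

  \<comment> \<open>the members at \<open>x0\<close> and at \<open>s k\<close> belong to the exponents \<open>q\<close> and \<open>p\<close>: \<open>\<bar>E n w\<bar>\<close> is controlled by \<open>\<bar>W n\<bar> powr Re w\<close>\<close>
  define E where "E n w z = g n z * exp ((w - x0) * Ln (W n z))" for n w z
  have E_x0: "E n x0 z = g n z" for n z by (simp add: E_def)
  have E_bound: "cmod (E n w z) \<le> cmod (W n z) powr Re w * exp pi"
    if "w \<in> \<Omega>" "cmod z \<le> 1" for n w z
  proof -
    have "cmod (E n w z) \<le> cmod (W n z) powr (2 / q) * (cmod (W n z) powr Re (w - x0) * exp pi)"
      unfolding E_def norm_mult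
      using that W(2,3)[OF that(2), of n] by (intro mult_mono Ln_power_bound) (auto simp: \<Omega>_def x0_def)
    also have "\<dots> = cmod (W n z) powr Re w * exp pi"
      using W1[OF that(2), of n] by (simp add: x0_def flip: powr_add)
    finally show ?thesis .
  qed
  have E_hol: "E n w holomorphic_on ball 0 1" for n w
  proof -
    have "W n z \<notin> \<real>\<^sub>\<le>\<^sub>0" if "z \<in> ball 0 1" for z
      using W(2)[of z n] that by (auto elim!: nonpos_Reals_cases)
    then show ?thesis unfolding E_def by (intro holomorphic_intros g hW) auto
  qed
  have E_lim: "(\<lambda>n. E n w z) \<longlonglongrightarrow> 0" if w: "w \<in> \<Omega>" and z: "cmod z < 1" for w z
  proof -
    \<comment> \<open>point evaluation is composition with a constant map, so subordination bounds \<open>W n z\<close>\<close>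
    have "\<exists>V\<ge>1. \<forall>n. cmod (W n z) \<le> V"
    proof -
      have self: "holomorphic_self_map (\<lambda>_. z)" using z by (auto simp: holomorphic_self_map_def)
      define V where "V = subordination_const (\<lambda>_. z) * D"
      have "(cmod (W n z))\<^sup>2 \<le> V" for n using WD[OF self, of "1/2" n] by (simp add: V_def)
      then have "cmod (W n z) \<le> max 1 V" for n
        using W1[of z n] z self_le_power[of "cmod (W n z)" 2] by (smt (verit) less_imp_le zero_less_numeral)
      then show ?thesis by (intro exI[of _ "max 1 V"]) auto
    qed
    then obtain V where V: "V \<ge> 1" "\<And>n. cmod (W n z) \<le> V" by blast
    define A where "A = V powr \<bar>Re (w - x0)\<bar> * exp pi"
    have le: "cmod (E n w z) \<le> cmod (g n z) * A" for n
    proof -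
      have W1z: "1 \<le> cmod (W n z)" using W1 z by simp
      have "cmod (exp ((w - x0) * Ln (W n z))) \<le> cmod (W n z) powr Re (w - x0) * exp pi"
        using w W(2)[of z n] z by (intro Ln_power_bound) (auto simp: \<Omega>_def x0_def)
      also have "\<dots> \<le> A"
      proof -
        have "cmod (W n z) powr Re (w - x0) \<le> cmod (W n z) powr \<bar>Re (w - x0)\<bar>"
          using W1z by (intro powr_mono) auto
        also have "\<dots> \<le> V powr \<bar>Re (w - x0)\<bar>" using V(2) by (intro powr_mono2) auto
        finally show ?thesis unfolding A_def by (intro mult_right_mono) auto
      qed
      finally show ?thesis unfolding E_def norm_mult by (intro mult_left_mono) auto
    qed
    have "(\<lambda>n. cmod (g n z) * A) \<longlonglongrightarrow> 0"
      by (intro tendsto_mult_left_zero tendsto_norm_zero lim z)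
    then show ?thesis
      by (rule Lim_null_comparison[rotated]) (simp add: le)
  qed

  define F where "F k n z = (if cmod z < 1 then E n (s k) z else 0)" for k n z
  have F_hol: "F k n holomorphic_on ball 0 1" for k n
    by (rule holomorphic_transform[OF E_hol[of n "s k"]]) (simp add: F_def)
  have F_power: "hardy_power p (F k n) \<le> ennreal (exp (p * pi) * D)" for k n
  proof (subst hardy_power_le_iff[OF F_hol p], use D0 in simp, safe)
    fix r :: real assume r: "0 < r" "r < 1"
    have cWr: "continuous_on (sphere 0 1) (\<lambda>z. (cmod (W n (of_real r * z)))\<^sup>2)"
      by (intro continuous_intros continuous_on_compose2[OF cW[of UNIV]]) auto
    have "circle_mean (\<lambda>z. cmod (F k n (of_real r * z)) powr p)
       \<le> circle_mean (\<lambda>z. exp (p * pi) * (cmod (W n (of_real r * z)))\<^sup>2)"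
    proof (rule circle_mean_mono)
      show "continuous_on (sphere 0 1) (\<lambda>z. cmod (F k n (of_real r * z)) powr p)"
        by (intro continuous_on_norm_powr p continuous_on_dilated_circle r holomorphic_on_imp_continuous_on F_hol)
      show "continuous_on (sphere 0 1) (\<lambda>z. exp (p * pi) * (cmod (W n (of_real r * z)))\<^sup>2)"
        by (intro continuous_on_mult continuous_on_const cWr)
      fix z :: complex assume "cmod z = 1"
      then have z: "cmod (of_real r * z) < 1" using r by (simp add: norm_mult)
      then have "cmod (F k n (of_real r * z)) powr p \<le> (cmod (W n (of_real r * z)) powr (2 / p) * exp pi) powr p"
        using E_bound[OF s\<Omega>(1)[of k], of "of_real r * z" n] s1(1)[of k] p
        by (intro powr_mono2) (auto simp: F_def)
      also have "\<dots> = cmod (W n (of_real r * z)) powr 2 * exp (p * pi)"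
        using p by (simp add: powr_mult powr_powr exp_powr_real mult.commute)
      finally show "cmod (F k n (of_real r * z)) powr p \<le> exp (p * pi) * (cmod (W n (of_real r * z)))\<^sup>2"
        by (simp add: mult.commute)
    qed
    also have "\<dots> = exp (p * pi) * circle_mean (\<lambda>z. (cmod (W n (of_real r * z)))\<^sup>2)"
      by (rule circle_mean_cmult)
    also have "\<dots> \<le> exp (p * pi) * D"
      using WD[OF holomorphic_self_map_id r, of n] by (simp add: subordination_const_def)
    finally show "circle_mean (\<lambda>z. cmod (F k n (of_real r * z)) powr p) \<le> exp (p * pi) * D" .
  qed
  have F_space: "F k n \<in> hardy_space p" for k n
    by (rule hardy_spaceI[OF F_hol _ F_power]) (simp add: F_def)
  have F_null: "(\<lambda>n. hardy_power p (T (F k n))) \<longlonglongrightarrow> 0" for k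
  proof (rule null[OF F_space F_power])
    fix z :: complex assume "cmod z < 1"
    then show "(\<lambda>n. F k n z) \<longlonglongrightarrow> 0" using E_lim[OF s\<Omega>(1)[of k]] by (simp add: F_def)
  qed
  define a where "a k n = enn2real (hardy_power p (T (F k n)))" for k n
  have a: "hardy_power p (T (F k n)) = ennreal (a k n)" "a k n \<ge> 0" for k n
    using hardy_spaceD(3)[OF T_hardy_space[OF p F_space]] by (auto simp: a_def)
  have a_lim: "(\<lambda>n. a k n) \<longlonglongrightarrow> 0" for k
    using F_null[of k] by (simp add: a ennreal_tendsto_0_iff)

  \<comment> \<open>normalizing by \<open>M\<close> makes the exponential sums below uniformly bounded\<close>
  define M where "M n w = (\<Sum>j=1..N. cmod (W n (\<phi> j w)))" for n w
  have M: "1 \<le> M n w" "\<And>j. j \<in> {1..N} \<Longrightarrow> cmod (W n (\<phi> j w)) \<le> M n w" if w: "cmod w < 1" for n w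
  proof -
    show le: "\<And>j. j \<in> {1..N} \<Longrightarrow> cmod (W n (\<phi> j w)) \<le> M n w"
      unfolding M_def by (rule member_le_sum) auto
    show "1 \<le> M n w"
      using le[of 1] W1[of "\<phi> 1 w" n] phi_disk[OF _ w, of 1] N by auto
  qed
  define C where "C = (\<Sum>j=1..N. cmod (c j)) * exp pi"
  define S where "S = real N * (\<Sum>j=1..N. subordination_const (\<phi> j) * D)"
  have S0: "S \<ge> 0"
    unfolding S_def using subordination_const_ge_1[OF phi] D0
    by (intro mult_nonneg_nonneg sum_nonneg) (auto intro: order_trans[OF zero_le_one])

  have key: "\<exists>K::nat. \<forall>n w. cmod w < 1 \<longrightarrow>
      cmod (T (g n) w) powr q \<le> \<delta> * (M n w)\<^sup>2 + real K * (\<Sum>k<K. cmod (T (F k n) w) powr p)"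
    if \<delta>: "\<delta> > 0" for \<delta>
  proof -
    obtain K :: nat where K: "\<And>G. G holomorphic_on \<Omega> \<Longrightarrow> (\<And>z. z \<in> \<Omega> \<Longrightarrow> cmod (G z) \<le> C) \<Longrightarrow>
      cmod (G x0) powr q \<le> \<delta> + real K * (\<Sum>k<K. cmod (G (s k)) powr p)"
      using two_constants_normal_families[OF \<Omega> x\<Omega> s\<Omega> slim p q \<delta>, where C = C] by metis
    have "cmod (T (g n) w) powr q \<le> \<delta> * (M n w)\<^sup>2 + real K * (\<Sum>k<K. cmod (T (F k n) w) powr p)"
      if w: "cmod w < 1" for n w
    proof -
      define G where "G z = (\<Sum>j=1..N. c j * E n z (\<phi> j w)) * exp (- z * of_real (ln (M n w)))" for z
      have M1: "1 \<le> M n w" by (rule M(1)[OF w])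
      have normG: "cmod (G z) = cmod (\<Sum>j=1..N. c j * E n z (\<phi> j w)) * M n w powr (- Re z)" for z
        unfolding G_def norm_mult using M1 by (simp add: powr_def)
      have 1: "G holomorphic_on \<Omega>"
        unfolding G_def E_def by (intro holomorphic_intros)
      have 2: "cmod (G z) \<le> C" if z: "z \<in> \<Omega>" for z
      proof -
        have "cmod (\<Sum>j=1..N. c j * E n z (\<phi> j w)) \<le> (\<Sum>j=1..N. cmod (c j) * (M n w powr Re z * exp pi))"
        proof (rule sum_norm_le)
          fix j assume j: "j \<in> {1..N}"
          have "cmod (E n z (\<phi> j w)) \<le> cmod (W n (\<phi> j w)) powr Re z * exp pi"
            using phi_disk[OF j w] by (intro E_bound z) auto
          also have "\<dots> \<le> M n w powr Re z * exp pi"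
            using M(2)[OF w j] z by (intro mult_right_mono powr_mono2) (auto simp: \<Omega>_def)
          finally show "cmod (c j * E n z (\<phi> j w)) \<le> cmod (c j) * (M n w powr Re z * exp pi)"
            unfolding norm_mult by (intro mult_left_mono) auto
        qed
        also have "\<dots> = C * M n w powr Re z"
          unfolding C_def sum_distrib_right by (intro sum.cong) (simp_all add: mult_ac)
        finally have "cmod (G z) \<le> C * M n w powr Re z * M n w powr (- Re z)"
          unfolding normG by (intro mult_right_mono) auto
        also have "\<dots> = C" using M1 by (simp add: mult.assoc flip: powr_add)
        finally show ?thesis .
      qed
      have M2: "0 < (M n w)\<^sup>2" using M1 by simp
      have G0: "cmod (T (g n) w) powr q = (M n w)\<^sup>2 * cmod (G x0) powr q"
      proof -
        have "cmod (G x0) = cmod (T (g n) w) * M n w powr (- (2 / q))"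
          unfolding normG by (simp add: T_apply[OF w] E_x0) (simp add: x0_def)
        then have "cmod (G x0) powr q = cmod (T (g n) w) powr q * M n w powr (- 2)"
          using q by (simp add: powr_mult powr_powr)
        then show ?thesis using M1 by (simp add: powr_minus field_simps)
      qed
      have Gs: "(M n w)\<^sup>2 * cmod (G (s k)) powr p = cmod (T (F k n) w) powr p" for k
      proof -
        have "(\<Sum>j=1..N. c j * E n (s k) (\<phi> j w)) = T (F k n) w"
          unfolding T_apply[OF w] by (rule sum.cong) (use phi_disk[OF _ w] in \<open>auto simp: F_def\<close>)
        then have "cmod (G (s k)) = cmod (T (F k n) w) * M n w powr (- (2 / p))"
          unfolding normG s1(1) by simp
        then have "cmod (G (s k)) powr p = cmod (T (F k n) w) powr p * M n w powr (- 2)"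
          using p by (simp add: powr_mult powr_powr)
        then show ?thesis using M1 by (simp add: powr_minus field_simps)
      qed
      have "cmod (T (g n) w) powr q \<le> (M n w)\<^sup>2 * (\<delta> + real K * (\<Sum>k<K. cmod (G (s k)) powr p))"
        unfolding G0 using M2 by (intro mult_left_mono K 1 2) auto
      also have "\<dots> = \<delta> * (M n w)\<^sup>2 + real K * (\<Sum>k<K. (M n w)\<^sup>2 * cmod (G (s k)) powr p)"
        by (simp add: distrib_left sum_distrib_left mult_ac)
      finally show ?thesis unfolding Gs .
    qed
    then show ?thesis by blast
  qed

  show ?thesis
  proof (rule tendsto_0_ennrealI)
    fix e :: real assume e: "e > 0"
    define \<delta> where "\<delta> = e / (2 * (S + 1))"
    have \<delta>: "\<delta> > 0" using e S0 by (simp add: \<delta>_def)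
    have \<delta>S: "\<delta> * S \<le> e / 2" using e S0 by (simp add: \<delta>_def field_simps)
    from key[OF \<delta>] obtain K :: nat where K: "\<And>n w. cmod w < 1 \<Longrightarrow>
      cmod (T (g n) w) powr q \<le> \<delta> * (M n w)\<^sup>2 + real K * (\<Sum>k<K. cmod (T (F k n) w) powr p)" by blast
    have bound: "hardy_power q (T (g n)) \<le> ennreal (\<delta> * S + real K * (\<Sum>k<K. a k n))" for n
    proof (subst hardy_power_le_iff[OF T_holomorphic[OF g(2)] q])
      show "0 \<le> \<delta> * S + real K * (\<Sum>k<K. a k n)"
        using \<delta> S0 a(2) by (intro add_nonneg_nonneg mult_nonneg_nonneg sum_nonneg) auto
      show "\<forall>r>0. r < 1 \<longrightarrow> circle_mean (\<lambda>z. cmod (T (g n) (of_real r * z)) powr q) \<le> \<delta> * S + real K * (\<Sum>k<K. a k n)"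
      proof safe
        fix r :: real assume r: "0 < r" "r < 1"
        let ?U = "\<lambda>j z. (cmod (W n (\<phi> j (of_real r * z))))\<^sup>2"
        let ?A = "\<lambda>k z. cmod (T (F k n) (of_real r * z)) powr p"
        have cU: "continuous_on (sphere 0 1) (?U j)" if "j \<in> {1..N}" for j
          by (intro continuous_on_power continuous_on_norm continuous_on_compose2[OF cW[of UNIV]]
               continuous_on_dilated_circle r holomorphic_on_imp_continuous_on
               holomorphic_self_mapD(1)[OF phi[OF that]]) auto
        have cA: "continuous_on (sphere 0 1) (?A k)" for k
          by (intro continuous_on_norm_powr p continuous_on_dilated_circle r
               holomorphic_on_imp_continuous_on T_holomorphic F_hol)
        have "circle_mean (\<lambda>z. cmod (T (g n) (of_real r * z)) powr q)
           \<le> circle_mean (\<lambda>z. \<delta> * real N * (\<Sum>j=1..N. ?U j z) + real K * (\<Sum>k<K. ?A k z))"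
        proof (rule circle_mean_mono)
          show "continuous_on (sphere 0 1) (\<lambda>z. cmod (T (g n) (of_real r * z)) powr q)"
            by (intro continuous_on_norm_powr q continuous_on_dilated_circle r
               holomorphic_on_imp_continuous_on T_holomorphic g)
          show "continuous_on (sphere 0 1) (\<lambda>z. \<delta> * real N * (\<Sum>j=1..N. ?U j z) + real K * (\<Sum>k<K. ?A k z))"
            by (intro continuous_on_add continuous_on_mult continuous_on_const continuous_on_sum cU cA)
          fix z :: complex assume "cmod z = 1"
          then have z: "cmod (of_real r * z) < 1" using r by (simp add: norm_mult)
          have "(M n (of_real r * z))\<^sup>2 \<le> (\<Sum>j=1..N. ?U j z) * real (card {1..N})"
            unfolding M_def by (rule sum_squared_le_sum_of_squares)
          then have "\<delta> * (M n (of_real r * z))\<^sup>2 \<le> \<delta> * ((\<Sum>j=1..N. ?U j z) * real N)"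
            using \<delta> by (intro mult_left_mono) auto
          then show "cmod (T (g n) (of_real r * z)) powr q \<le> \<delta> * real N * (\<Sum>j=1..N. ?U j z) + real K * (\<Sum>k<K. ?A k z)"
            using K[OF z, of n] by (simp add: mult_ac)
        qed
        also have "\<dots> = \<delta> * real N * (\<Sum>j=1..N. circle_mean (?U j)) + real K * (\<Sum>k<K. circle_mean (?A k))"
        proof -
          have "circle_mean (\<lambda>z. \<delta> * real N * (\<Sum>j=1..N. ?U j z) + real K * (\<Sum>k<K. ?A k z))
             = circle_mean (\<lambda>z. \<delta> * real N * (\<Sum>j=1..N. ?U j z)) + circle_mean (\<lambda>z. real K * (\<Sum>k<K. ?A k z))"
            by (intro circle_mean_add continuous_on_mult continuous_on_const continuous_on_sum cU cA)
          also have "\<dots> = \<delta> * real N * circle_mean (\<lambda>z. \<Sum>j=1..N. ?U j z) + real K * circle_mean (\<lambda>z. \<Sum>k<K. ?A k z)"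
            by (simp only: circle_mean_cmult)
          also have "circle_mean (\<lambda>z. \<Sum>j=1..N. ?U j z) = (\<Sum>j=1..N. circle_mean (?U j))"
            by (intro circle_mean_sum cU) auto
          also have "circle_mean (\<lambda>z. \<Sum>k<K. ?A k z) = (\<Sum>k<K. circle_mean (?A k))"
            by (intro circle_mean_sum cA) auto
          finally show ?thesis .
        qed
        also have "\<dots> \<le> \<delta> * real N * (\<Sum>j=1..N. subordination_const (\<phi> j) * D) + real K * (\<Sum>k<K. a k n)"
        proof (intro add_mono mult_left_mono sum_mono)
          show "circle_mean (?U j) \<le> subordination_const (\<phi> j) * D" if "j \<in> {1..N}" for j
            by (rule WD[OF phi[OF that] r])
          have "hardy_power p (T (F k n)) \<le> ennreal (a k n)" for k using a(1) by simp
          then show "circle_mean (?A k) \<le> a k n" for k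
            using hardy_power_le_iff[OF T_holomorphic[OF F_hol] p a(2)] r by blast
        qed (use \<delta> in auto)
        also have "\<dots> = \<delta> * S + real K * (\<Sum>k<K. a k n)" by (simp add: S_def)
        finally show "circle_mean (\<lambda>z. cmod (T (g n) (of_real r * z)) powr q) \<le> \<delta> * S + real K * (\<Sum>k<K. a k n)" .
      qed
    qed
    have "(\<lambda>n. real K * (\<Sum>k<K. a k n)) \<longlonglongrightarrow> real K * (\<Sum>k<K. 0)"
      by (intro tendsto_mult tendsto_const tendsto_sum a_lim)
    then have "\<forall>\<^sub>F n in sequentially. real K * (\<Sum>k<K. a k n) < e / 2"
      using e by (intro order_tendstoD(2)[where y = 0]) auto
    then show "\<forall>\<^sub>F n in sequentially. hardy_power q (T (g n)) \<le> ennreal e"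
    proof (rule eventually_mono)
      fix n assume "real K * (\<Sum>k<K. a k n) < e / 2"
      then have "\<delta> * S + real K * (\<Sum>k<K. a k n) \<le> e" using \<delta>S by simp
      then show "hardy_power q (T (g n)) \<le> ennreal e"
        by (rule order_trans[OF bound ennreal_leI])
    qed
  qed
qed

text \<open>To pass from dilates to \<open>f n\<close> itself, the bound by \<open>e\<close> is needed for all dilates of \<open>f n\<close> at once. So
  the radius \<open>r n\<close> is taken to violate this bound if some radius does; since \<open>null_transfer\<close>
  applies to the sequence of the dilates with radius \<open>r n\<close>, no radius violates it for large \<open>n\<close>.\<close>

lemma compact_on_hardy_transfer:
  assumes p: "p > 0" and q: "q > 0" and comp: "compact_on_hardy p T"
  shows "compact_on_hardy q T"
proof (rule null_imp_compact[OF q])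
  fix f B0
  assume f: "\<And>n. f n \<in> hardy_space q" and B0: "\<And>n. hardy_power q (f n) \<le> ennreal B0"
    and unif: "\<And>R. 0 < R \<Longrightarrow> R < 1 \<Longrightarrow> uniform_limit (cball 0 R) f (\<lambda>z. 0) sequentially"
  define B where "B = max 0 B0"
  have B: "hardy_power q (f n) \<le> ennreal B" "B \<ge> 0" for n
    using order_trans[OF B0 ennreal_leI[of B0 B]] by (auto simp: B_def)
  note hf = hardy_spaceD(1)[OF f]
  show "(\<lambda>n. hardy_power q (T (f n))) \<longlonglongrightarrow> 0"
  proof (rule tendsto_0_ennrealI)
    fix e :: real assume e: "e > 0"
    define bad where "bad n r \<longleftrightarrow> 0 < r \<and> r < 1 \<and> \<not> hardy_power q (T (\<lambda>z. f n (of_real r * z))) \<le> ennreal e" for n r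
    define r where "r n = (if \<exists>t. bad n t then SOME t. bad n t else 1 / 2)" for n
    have r: "0 < r n" "r n < 1" and r_bad: "\<And>t. bad n t \<Longrightarrow> bad n (r n)" for n
    proof -
      have "bad n (r n)" if "bad n t" for t
        unfolding r_def using someI[of "bad n" t] that by auto
      then show "\<And>t. bad n t \<Longrightarrow> bad n (r n)" .
      then show "0 < r n" "r n < 1"
        by (cases "\<exists>t. bad n t"; force simp: bad_def r_def)+
    qed
    define g where "g n = (\<lambda>z. f n (of_real (r n) * z))" for n
    have "(\<lambda>n. hardy_power q (T (g n))) \<longlonglongrightarrow> 0"
    proof (rule null_transfer[OF p q compact_imp_null[OF p comp]])
      show "continuous_on (cball 0 1) (g n)" "g n holomorphic_on ball 0 1" for n
        unfolding g_def by (rule dilation_holomorphic[OF hf r])+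
      show "circle_mean (\<lambda>z. cmod (g n z) powr q) \<le> B" for n
        using B r hardy_power_le_iff[OF hf q, of B n] unfolding g_def by blast
      show "(\<lambda>n. g n z) \<longlonglongrightarrow> 0" if z: "cmod z < 1" for z
      proof (rule tendstoI)
        fix \<epsilon> :: real assume \<epsilon>: "\<epsilon> > 0"
        define R where "R = (1 + cmod z) / 2"
        have R: "0 < R" "R < 1" "cmod z \<le> R" using z by (auto simp: R_def add_pos_nonneg)
        have "\<forall>\<^sub>F n in sequentially. \<forall>x\<in>cball 0 R. dist (f n x) 0 < \<epsilon>"
          using unif[OF R(1,2)] \<epsilon> by (rule uniform_limitD)
        then show "\<forall>\<^sub>F n in sequentially. dist (g n z) 0 < \<epsilon>"
        proof (rule eventually_mono)
          fix n assume *: "\<forall>x\<in>cball 0 R. dist (f n x) 0 < \<epsilon>"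
          have "r n * cmod z \<le> 1 * cmod z" using r[of n] by (intro mult_right_mono) auto
          then have "of_real (r n) * z \<in> cball 0 R" using R r[of n] by (simp add: norm_mult)
          then show "dist (g n z) 0 < \<epsilon>" unfolding g_def using * by blast
        qed
      qed
    qed (assumption+)
    then have "\<forall>\<^sub>F n in sequentially. hardy_power q (T (g n)) < ennreal e"
      using e by (intro order_tendstoD(2)) auto
    then show "\<forall>\<^sub>F n in sequentially. hardy_power q (T (f n)) \<le> ennreal e"
    proof (rule eventually_mono)
      fix n assume "hardy_power q (T (g n)) < ennreal e"
      then have "\<not> bad n (r n)" by (simp add: bad_def g_def less_imp_le)
      then have good: "hardy_power q (T (\<lambda>z. f n (of_real t * z))) \<le> ennreal e" if "0 < t" "t < 1" for t
        using r_bad[of n t] that by (auto simp: bad_def)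
      define t where "t m = 1 - 1 / real (m + 2)" for m
      have t: "0 < t m" "t m < 1" for m by (auto simp: t_def field_simps)
      show "hardy_power q (T (f n)) \<le> ennreal e"
      proof (rule hardy_power_Fatou[where f = "\<lambda>m. T (\<lambda>z. f n (of_real (t m) * z))"])
        show "T (\<lambda>z. f n (of_real (t m) * z)) holomorphic_on ball 0 1" for m
          by (rule T_holomorphic[OF dilation_holomorphic(2)[OF hf t]])
        show "(\<lambda>m. T (\<lambda>z. f n (of_real (t m) * z)) z) \<longlonglongrightarrow> T (f n) z" if "cmod z < 1" for z
          by (rule T_tendsto[OF _ that]) (unfold t_def, rule dilation_tendsto[OF hf])
      qed (use good t T_holomorphic[OF hf] q in auto)
    qed
  qed
qed

end

theorem theorem1p1:
  fixes N :: nat and \<phi> :: "nat \<Rightarrow> complex \<Rightarrow> complex" and c :: "nat \<Rightarrow> complex"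
    and T :: "(complex \<Rightarrow> complex) \<Rightarrow> complex \<Rightarrow> complex"
  assumes "N \<ge> 1"
    and "\<And>j. j \<in> {1..N} \<Longrightarrow> holomorphic_self_map (\<phi> j)"
    and "T = (\<lambda>f z. \<Sum>j=1..N. c j * comp_op (\<phi> j) f z)"
  shows "\<forall>p>0. \<forall>q>0. compact_on_hardy p T \<longleftrightarrow> compact_on_hardy q T"
proof -
  interpret composition_combination N \<phi> c T
    using assms by unfold_locales
  show ?thesis using compact_on_hardy_transfer by blast
qed

end
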